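(* Let $\mathbf{A}_1\in\mathbb{H}^{m\times n}_{r_1}$, $\mathbf{A}_2\in\mathbb{H}^{m\times p}_{r_2}$, $\mathbf{B}_2\in\mathbb{H}^{q\times s}_{r_3}$, $\mathbf{C}\in\mathbb{H}^{m\times s}$, let $\mathbf{M}=\mathbf{R}_{A_1}\mathbf{A}_2$ and assume $\operatorname{rank}\mathbf{M}=\min\{\operatorname{rank}\mathbf{A}_2,\operatorname{rank}\mathbf{R}_{A_1}\}=r_4$. Let $\mathbf{X}_1=\mathbf{A}_1^\dagger\mathbf{C}-\mathbf{A}_1^\dagger\mathbf{A}_2\mathbf{M}^\dagger\mathbf{C}=(x^{(1)}_{ij})\in\mathbb{H}^{n\times s}$ and $\mathbf{X}_2=\mathbf{M}^\dagger\mathbf{C}\mathbf{B}_2^\dagger=(x^{(2)}_{gf})\in\mathbb{H}^{p\times q}$. Let $\tilde{\mathbf{a}}^{(2)}_{.t}$ be the $t$th column of $\tilde{\mathbf{A}}_2=\mathbf{A}_1^*\mathbf{A}_2$, let $\mathbf{c}^{(1)}_{.j}$, $\mathbf{c}^{(2)}_{.j}$ be the $j$th columns of $\mathbf{C}_1=\mathbf{A}_1^*\mathbf{C}$ and $\mathbf{C}_2=\mathbf{M}^*\mathbf{C}$, and let $\mathbf{c}^{(3)}_{k.}$, $\mathbf{c}^{(3)}_{.l}$ be the $k$th row and $l$th column of $\mathbf{C}_3=\mathbf{M}^*\mathbf{C}\mathbf{B}_2^*$. Then $$x^{(1)}_{ij}=\frac{\sum_{\beta\in J_{r_1,n}\{i\}}\mathrm{cdet}_i\big((\mathbf{A}_1^*\mathbf{A}_1)_{.i}(\mathbf{c}^{(1)}_{.j})\big)^\beta_\beta}{\sum_{\beta\in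 J_{r_1,n}}|\mathbf{A}_1^*\mathbf{A}_1|^\beta_\beta}-\frac{\sum_{t=1}^p\sum_{\beta\in J_{r_1,n}\{i\}}\mathrm{cdet}_i\big((\mathbf{A}_1^*\mathbf{A}_1)_{.i}(\tilde{\mathbf{a}}^{(2)}_{.t})\big)^\beta_\beta\sum_{\beta\in J_{r_4,p}\{t\}}\mathrm{cdet}_t\big((\mathbf{M}^*\mathbf{M})_{.t}(\mathbf{c}^{(2)}_{.j})\big)^\beta_\beta}{\sum_{\beta\in J_{r_1,n}}|\mathbf{A}_1^*\mathbf{A}_1|^\beta_\beta\sum_{\beta\in J_{r_4,p}}|\mathbf{M}^*\mathbf{M}|^\beta_\beta},$$ and $$x^{(2)}_{gf}=\frac{\sum_{\beta\in J_{r_4,p}\{g\}}\mathrm{cdet}_g\big((\mathbf{M}^*\mathbf{M})_{.g}(\mathbf{d}^{B_2}_{.f})\big)^\beta_\beta}{\sum_{\beta\in J_{r_4,p}}|\mathbf{M}^*\mathbf{M}|^\beta_\beta\sum_{\alpha\in I_{r_3,q}}|\mathbf{B}_2\mathbf{B}_2^*|^\alpha_\alpha}=\frac{\sum_{\alpha\in I_{r_3,q}\{f\}}\mathrm{rdet}_f\big((\mathbf{B}_2\mathbf{B}_2^* )_{f.}(\mathbf{d}^{M}_{g.})\big)^\alpha_\alpha}{\sum_{\beta\in J_{r_4,p}}|\mathbf{M}^*\mathbf{M}|^\beta_\beta\sum_{\alpha\in I_{r_3,q}}|\mathbf{B}_2\mathbf{B}_2^*|^\alpha_\alpha},$$ where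 $\mathbf{d}^{B_2}_{.f}\in\mathbb{H}^{p\times1}$ has $k$th entry $\sum_{\alpha\in I_{r_3,q}\{f\}}\mathrm{rdet}_f\big((\mathbf{B}_2\mathbf{B}_2^* )_{f.}(\mathbf{c}^{(3)}_{k.})\big)^\alpha_\alpha$ ($k=1,\dots,p$) and $\mathbf{d}^{M}_{g.}\in\mathbb{H}^{1\times q}$ has $l$th entry $\sum_{\beta\in J_{r_4,p}\{g\}}\mathrm{cdet}_g\big((\mathbf{M}^*\mathbf{M})_{.g}(\mathbf{c}^{(3)}_{.l})\big)^\beta_\beta$ ($l=1,\dots,q$).
   Context: $\mathbb{H}$ is the skew field of real quaternions; $\mathbb{H}^{m\times n}$ is the set of $m\times n$ matrices over $\mathbb{H}$ and $\mathbb{H}^{m\times n}_r$ the subset of those of rank $r$. $\mathbf{A}^*$ is the conjugate transpose and $\mathbf{A}^\dagger$ the Moore–Penrose inverse (the unique $\mathbf{X}$ with $\mathbf{AXA}=\mathbf{A}$, $\mathbf{XAX}=\mathbf{X}$, $(\mathbf{AX})^*=\mathbf{AX}$, $(\mathbf{XA})^*=\mathbf{XA}$). $\mathbf{R}_A=\mathbf{I}-\mathbf{A}\mathbf{A}^\dagger$. For a matrix $\mathbf{F}$, $\mathbf{F}_{.j}(\mathbf{b})$ (resp. $\mathbf{F}_{i.}(\mathbf{b})$) is $\mathbf{F}$ with its $j$th column (resp. $i$th row) replaced by the column (resp. row) $\mathbf{b}$. Row/column determinants: for $\mathbf{F}=(a_{ij})\in\mathbb{H}^{n\times n}$, $\mathrm{rdet}_i\mathbf{F}=\sum_{\sigma\in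 S_n}(-1)^{n-r}(a_{i\,i_{k_1}}a_{i_{k_1}i_{k_1+1}}\cdots a_{i_{k_1+l_1}i})\cdots(a_{i_{k_r}i_{k_r+1}}\cdots a_{i_{k_r+l_r}i_{k_r}})$, where $\sigma=(i\,i_{k_1}\,i_{k_1+1}\cdots i_{k_1+l_1})(i_{k_2}\cdots i_{k_2+l_2})\cdots(i_{k_r}\cdots i_{k_r+l_r})$ is the decomposition of $\sigma$ into $r$ disjoint cycles (fixed points included) with $i_{k_2}<\cdots<i_{k_r}$ and $i_{k_t}<i_{k_t+s}$ for $t=2,\dots,r$, $s=1,\dots,l_t$; and $\mathrm{cdet}_j\mathbf{F}=\sum_{\tau\in S_n}(-1)^{n-r}(a_{j_{k_r}j_{k_r+l_r}}\cdots a_{j_{k_r+1}j_{k_r}})\cdots(a_{j\,j_{k_1+l_1}}\cdots a_{j_{k_1+1}j_{k_1}}a_{j_{k_1}j})$, where $\tau=(j_{k_r+l_r}\cdots j_{k_r+1}\,j_{k_r})\cdots(j_{k_2+l_2}\cdots j_{k_2})(j_{k_1+l_1}\cdots j_{k_1+1}\,j_{k_1}\,j)$ is the decomposition into $r$ disjoint cycles with $j_{k_2}<\cdots<j_{k_r}$ and $j_{k_t}<j_{k_t+s}$ for $t=2,\dots,r$, $s=1,\dots,l_t$. For Hermitian $\mathbf{F}$ all these coincide and are real; this value is $\det\mathbf{F}$. Index sets: $L_{k,n}$ is the set of strictly increasing sequences $\alpha=(\alpha_1<\cdots<\alpha_k)$ in $\{1,\dots,n\}$; $I_{k,m}\{i\}=\{\alpha\in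 L_{k,m}: i\in\alpha\}$, $J_{k,n}\{j\}=\{\beta\in L_{k,n}: j\in\beta\}$; sums over $J_{k,n}$ or $I_{k,m}$ without braces run over all of $L_{k,n}$, $L_{k,m}$. For a square $\mathbf{F}$, $\mathbf{F}^\alpha_\alpha$ is the principal submatrix with rows and columns indexed by $\alpha$; $\mathrm{cdet}_i(\mathbf{G})^\beta_\beta$ (resp. $\mathrm{rdet}_j(\mathbf{G})^\alpha_\alpha$) is the column (resp. row) determinant of the principal submatrix $\mathbf{G}^\beta_\beta$ taken at the column (resp. row) coming from index $i$ (resp. $j$); for Hermitian $\mathbf{F}$, $|\mathbf{F}|^\alpha_\alpha=\det\mathbf{F}^\alpha_\alpha$. *)

theory Defs
  imports "Jordan_Normal_Form.Matrix" "HOL-Combinatorics.Permutations"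
begin

datatype quat = Quat (qRe: real) (qI: real) (qJ: real) (qK: real)

lemma quat_eq_iff: "x = y \<longleftrightarrow> qRe x = qRe y \<and> qI x = qI y \<and> qJ x = qJ y \<and> qK x = qK y"
  by (cases x; cases y) auto

definition qnorm2 :: "quat \<Rightarrow> real" where
  "qnorm2 x = (qRe x)^2 + (qI x)^2 + (qJ x)^2 + (qK x)^2"

definition qcnj :: "quat \<Rightarrow> quat" where
  "qcnj x = Quat (qRe x) (- qI x) (- qJ x) (- qK x)"

instantiation quat :: division_ring
begin
definition "0 = Quat 0 0 0 0"
definition "1 = Quat 1 0 0 0"
definition "x + y = Quat (qRe x + qRe y) (qI x + qI y) (qJ x + qJ y) (qK x + qK y)"
definition "x - y = Quat (qRe x - qRe y) (qI x - qI y) (qJ x - qJ y) (qK x - qK y)"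
definition "- x = Quat (- qRe x) (- qI x) (- qJ x) (- qK x)"
definition "x * y = Quat
   (qRe x * qRe y - qI x * qI y - qJ x * qJ y - qK x * qK y)
   (qRe x * qI y + qI x * qRe y + qJ x * qK y - qK x * qJ y)
   (qRe x * qJ y - qI x * qK y + qJ x * qRe y + qK x * qI y)
   (qRe x * qK y + qI x * qJ y - qJ x * qI y + qK x * qRe y)"
definition inverse_quat :: "quat \<Rightarrow> quat" where "inverse_quat x = Quat (qRe x / qnorm2 x) (- qI x / qnorm2 x) (- qJ x / qnorm2 x) (- qK x / qnorm2 x)"
definition divide_quat :: "quat \<Rightarrow> quat \<Rightarrow> quat" where "divide_quat x y = x * Quat (qRe y / qnorm2 y) (- qI y / qnorm2 y) (- qJ y / qnorm2 y) (- qK y / qnorm2 y)"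

lemma qnorm2_pos: "x \<noteq> (0::quat) \<Longrightarrow> qnorm2 x > 0"
proof -
  assume "x \<noteq> 0"
  hence "qRe x \<noteq> 0 \<or> qI x \<noteq> 0 \<or> qJ x \<noteq> 0 \<or> qK x \<noteq> 0"
    by (cases x) (auto simp: zero_quat_def)
  moreover have "(qRe x)^2 \<ge> 0" "(qI x)^2 \<ge> 0" "(qJ x)^2 \<ge> 0" "(qK x)^2 \<ge> 0" by simp_all
  ultimately show ?thesis unfolding qnorm2_def
    by (smt (verit) power2_less_eq_zero_iff)
qed

lemma qnorm2_sum_one:
  assumes "qJ a = 0 \<longrightarrow> qI a = 0 \<longrightarrow> qRe a = 0 \<longrightarrow> qK a \<noteq> 0"
  shows "qI a * qI a / qnorm2 a + (qJ a * qJ a / qnorm2 a + (qK a * qK a / qnorm2 a + qRe a * qRe a / qnorm2 a)) = 1"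
proof -
  have "qnorm2 a > 0" unfolding qnorm2_def using assms
    by (smt (verit) power2_less_eq_zero_iff zero_le_power2)
  have e: "qI a * qI a + (qJ a * qJ a + (qK a * qK a + qRe a * qRe a)) = qnorm2 a"
    by (simp add: qnorm2_def power2_eq_square)
  have "qI a * qI a / qnorm2 a + (qJ a * qJ a / qnorm2 a + (qK a * qK a / qnorm2 a + qRe a * qRe a / qnorm2 a))
      = (qI a * qI a + (qJ a * qJ a + (qK a * qK a + qRe a * qRe a))) / qnorm2 a"
    by (simp only: add_divide_distrib)
  also have "\<dots> = 1" using e \<open>qnorm2 a > 0\<close> by simp
  finally show ?thesis .
qed

instance
  apply standard
  apply (simp_all add: quat_eq_iff plus_quat_def minus_quat_def uminus_quat_def times_quat_def zero_quat_def one_quat_def algebra_simps divide_quat_def inverse_quat_def)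
  apply (rule qnorm2_sum_one; assumption)+
  done
end

definition qadj :: "quat mat \<Rightarrow> quat mat" where
  "qadj A = transpose_mat (map_mat qcnj A)"

definition is_mp_inverse :: "quat mat \<Rightarrow> quat mat \<Rightarrow> bool" where
  "is_mp_inverse A X \<longleftrightarrow> X \<in> carrier_mat (dim_col A) (dim_row A) \<and>
     A * X * A = A \<and> X * A * X = X \<and> qadj (A * X) = A * X \<and> qadj (X * A) = X * A"

definition mp_inverse :: "quat mat \<Rightarrow> quat mat" where
  "mp_inverse A = (THE X. is_mp_inverse A X)"

definition R_proj :: "quat mat \<Rightarrow> quat mat" where
  "R_proj A = 1\<^sub>m (dim_row A) - A * mp_inverse A"

definition cols_right_indep :: "quat mat \<Rightarrow> nat set \<Rightarrow> bool" where
  "cols_right_indep A J \<longleftrightarrow> J \<subseteq> {0..<dim_col A} \<and>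
     (\<forall>c. (\<forall>i<dim_row A. (\<Sum>j\<in>J. A $$ (i, j) * c j) = 0) \<longrightarrow> (\<forall>j\<in>J. c j = 0))"

definition qrank :: "quat mat \<Rightarrow> nat" where
  "qrank A = Max (card ` {J. cols_right_indep A J})"

definition replace_col :: "quat mat \<Rightarrow> nat \<Rightarrow> quat vec \<Rightarrow> quat mat" where
  "replace_col F j b = mat (dim_row F) (dim_col F) (\<lambda>(a, c). if c = j then b $ a else F $$ (a, c))"

definition replace_row :: "quat mat \<Rightarrow> nat \<Rightarrow> quat vec \<Rightarrow> quat mat" where
  "replace_row F i b = mat (dim_row F) (dim_col F) (\<lambda>(a, c). if a = i then b $ c else F $$ (a, c))"

text \<open>Matrices are indexed from 0. The determinants are defined for the principal
  submatrix of F whose rows and columns are indexed by the finite set S (in increasing order);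
  since the cycle-ordering conventions depend only on the relative order of indices,
  this is exactly rdet/cdet of the principal submatrix F^S_S.\<close>

definition cyc_len :: "(nat \<Rightarrow> nat) \<Rightarrow> nat \<Rightarrow> nat" where
  "cyc_len \<sigma> m = (LEAST k. 0 < k \<and> (\<sigma> ^^ k) m = m)"

definition cyc_prod :: "quat mat \<Rightarrow> (nat \<Rightarrow> nat) \<Rightarrow> nat \<Rightarrow> quat" where
  "cyc_prod F \<sigma> m = prod_list (map (\<lambda>k. F $$ ((\<sigma> ^^ k) m, (\<sigma> ^^ Suc k) m)) [0..<cyc_len \<sigma> m])"

definition orbit_of :: "(nat \<Rightarrow> nat) \<Rightarrow> nat \<Rightarrow> nat set" where
  "orbit_of \<sigma> i = {(\<sigma> ^^ k) i | k. True}"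

definition leaders :: "nat set \<Rightarrow> (nat \<Rightarrow> nat) \<Rightarrow> nat \<Rightarrow> nat list" where
  "leaders S \<sigma> i = sorted_list_of_set
     {m \<in> S. m \<notin> orbit_of \<sigma> i \<and> (\<forall>k. m \<le> (\<sigma> ^^ k) m)}"

text \<open>Sign (-1)^(n-r), r = number of disjoint cycles (fixed points included)\<close>
definition cyc_sign :: "nat set \<Rightarrow> (nat \<Rightarrow> nat) \<Rightarrow> nat \<Rightarrow> quat" where
  "cyc_sign S \<sigma> i = (- 1) ^ (card S - Suc (length (leaders S \<sigma> i)))"

definition rdet_on :: "nat set \<Rightarrow> nat \<Rightarrow> quat mat \<Rightarrow> quat" where
  "rdet_on S i F = (\<Sum>\<sigma> \<in> {\<sigma>. \<sigma> permutes S}.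
      cyc_sign S \<sigma> i * prod_list (map (cyc_prod F \<sigma>) (i # leaders S \<sigma> i)))"

definition cdet_on :: "nat set \<Rightarrow> nat \<Rightarrow> quat mat \<Rightarrow> quat" where
  "cdet_on S j F = (\<Sum>\<tau> \<in> {\<tau>. \<tau> permutes S}.
      cyc_sign S \<tau> j * prod_list (map (cyc_prod F \<tau>) (rev (leaders S \<tau> j) @ [j])))"

definition rdet :: "nat \<Rightarrow> quat mat \<Rightarrow> quat" where
  "rdet i F = rdet_on {0..<dim_row F} i F"
definition cdet :: "nat \<Rightarrow> quat mat \<Rightarrow> quat" where
  "cdet j F = cdet_on {0..<dim_row F} j F"

text \<open>Determinant |F|^S_S of a principal submatrix of a Hermitian matrix (all row and column
  determinants coincide there; we take the column determinant at the first index);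
  the empty principal minor is 1.\<close>
definition hdet_on :: "nat set \<Rightarrow> quat mat \<Rightarrow> quat" where
  "hdet_on S F = (if S = {} then 1 else cdet_on S (Min S) F)"

definition Lset :: "nat \<Rightarrow> nat \<Rightarrow> nat set set" where
  "Lset k n = {\<beta>. \<beta> \<subseteq> {0..<n} \<and> card \<beta> = k}"
definition Lset_with :: "nat \<Rightarrow> nat \<Rightarrow> nat \<Rightarrow> nat set set" where
  "Lset_with k n i = {\<beta> \<in> Lset k n. i \<in> \<beta>}"

end

theory Submission
  imports Defs "HOL-Combinatorics.Cycles"
begin

text \<open>
  Splitting a permutation into the cycle through a fixed index and the rest expands row and
  column determinants over cycles. For a Hermitian matrix \<open>F\<close>, reversing a cycle conjugates its
  weight, and rotating it preserves the real part of its weight; hence the determinants are real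
  and do not depend on the chosen index. The cofactors become signed sums over simple paths, and
  cancelling walks that revisit their starting point yields Cramer's rule. Summed over all principal
  submatrices of order \<open>k\<close>, the cofactors form a matrix \<open>N\<^sub>k\<close> with
  \<open>F N\<^sub>k = d\<^sub>k I - N\<^sub>k\<^sub>+\<^sub>1\<close>, where \<open>d\<^sub>k\<close> is the sum of the principal minors.

  For \<open>F = A\<^sup>* A\<close> with \<open>A\<close> of rank \<open>r\<close>, minors on independent columns are positive and the others
  vanish, so \<open>d\<^sub>r > 0\<close> and \<open>N\<^sub>r\<^sub>+\<^sub>1 A\<^sup>* = 0\<close>. The Penrose equations then identify
  \<open>N\<^sub>r A\<^sup>* / d\<^sub>r\<close> as the Moore--Penrose inverse of \<open>A\<close>. Applied to \<open>A\<^sup>*\<close>, which has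
  the same rank, this gives the row version.
\<close>

section \<open>Row and column determinants as sums over cycles\<close>

text \<open>With noncommuting entries the alternating and multiplicative calculus of determinants
  breaks down, so Laplace expansion and Cauchy-Binet have to be replaced by the combinatorics of
  cycles and paths. Two remnants of commutativity carry the argument: the real part of a product is
  invariant under cyclic rotation, and real quaternions are central. Complementary minors are
  therefore shown to be real before they are moved past path weights.

  The matrices of cofactor sums have a commutative model: the adjugate of \<open>t I + F\<close> is
  the sum of \<open>t^(n-k) N_k\<close>, its determinant is the sum of \<open>t^(n-k) d_k\<close>,
  and comparing coefficients in \<open>(t I + F) adj(t I + F) = det(t I + F) I\<close> gives the
  recursion. Here it is proved entry by entry, by pairing an index set that omits \<open>i\<close>
  with the set obtained by adding \<open>i\<close>. The order \<open>k = r\<close> is the one at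
  which the remainder of the recursion dies against the adjoint of \<open>A\<close> while the scalar
  \<open>d_k\<close> is still invertible.\<close>

fun path_wt :: "quat mat \<Rightarrow> nat list \<Rightarrow> quat" where
  "path_wt F (x # y # zs) = F $$ (x, y) * path_wt F (y # zs)"
| "path_wt F _ = 1"

definition cycle_wt :: "quat mat \<Rightarrow> nat list \<Rightarrow> quat" where
  "cycle_wt F xs = path_wt F (xs @ [hd xs])"

text \<open>Each cycle through \<open>i\<close> is recorded exactly once, by the list that starts at
  \<open>i\<close>.\<close>

definition cycles_at :: "nat set \<Rightarrow> nat \<Rightarrow> nat list set" where
  "cycles_at S i = {xs. xs \<noteq> [] \<and> hd xs = i \<and> distinct xs \<and> set xs \<subseteq> S}"

lemma path_wt_append: "path_wt F (us @ v # ws) = path_wt F (us @ [v]) * path_wt F (v # ws)"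
proof (induction us)
  case (Cons a us)
  then show ?case by (cases us) (auto simp: mult.assoc)
qed simp

text \<open>This is the shape of \<open>cyc_prod\<close>, which multiplies over iterates of the
  permutation.\<close>

lemma path_wt_nth:
  "path_wt F zs = prod_list (map (\<lambda>k. F $$ (zs ! k, zs ! Suc k)) [0..<length zs - 1])"
proof (induction F zs rule: path_wt.induct)
  case (1 F x y zs)
  have "[0..<length (x # y # zs) - 1] = 0 # map Suc [0..<length (y # zs) - 1]"
    by (simp add: upt_conv_Cons map_Suc_upt del: upt_Suc)
  with 1 show ?case by (simp add: comp_def del: upt_Suc)
qed auto

lemma path_wt_cong:
  assumes "set zs \<subseteq> T" "\<And>a b. a \<in> T \<Longrightarrow> b \<in> T \<Longrightarrow> F $$ (a, b) = G $$ (a, b)"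
  shows "path_wt F zs = path_wt G zs"
  using assms(1)
proof (induction zs)
  case (Cons a zs)
  then show ?case by (cases zs) (auto simp: assms(2))
qed simp

lemma finite_cycles_at: "finite S \<Longrightarrow> finite (cycles_at S i)"
  by (rule finite_subset[OF _ finite_subset_distinct[of S]]) (auto simp: cycles_at_def)

section \<open>Splitting off the cycle through a fixed index\<close>

lemma cyc_len_eq_least_power: "cyc_len \<sigma> m = least_power \<sigma> m"
  by (simp add: cyc_len_def least_power_def conj_commute)

lemma funpow_agree:
  assumes "x \<in> X" "\<And>y. y \<in> X \<Longrightarrow> f y = g y" "\<And>y. y \<in> X \<Longrightarrow> g y \<in> X"
  shows "(f ^^ k) x = (g ^^ k) x" "(g ^^ k) x \<in> X"
proof -
  have "(f ^^ k) x = (g ^^ k) x \<and> (g ^^ k) x \<in> X" by (induction k) (auto simp: assms)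
  then show "(f ^^ k) x = (g ^^ k) x" "(g ^^ k) x \<in> X" by auto
qed

definition orbit_list :: "(nat \<Rightarrow> nat) \<Rightarrow> nat \<Rightarrow> nat list" where
  "orbit_list \<sigma> i = support \<sigma> i"

lemma orbit_list_cong:
  assumes "\<And>k. (\<sigma> ^^ k) m = (\<tau> ^^ k) m"
  shows "orbit_list \<sigma> m = orbit_list \<tau> m"
  by (simp add: assms least_power_def orbit_list_def)

lemma cycle_of_list_nth:
  assumes "distinct xs" "xs \<noteq> []"
  shows "(cycle_of_list xs ^^ k) (hd xs) = xs ! (k mod length xs)"
proof -
  have "(cycle_of_list xs ^^ k) (hd xs) = hd (map (cycle_of_list xs ^^ k) xs)"
    using assms by (simp add: hd_map)
  also have "\<dots> = xs ! (k mod length xs)"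
    by (simp add: cyclic_rotation[OF assms(1)] hd_rotate_conv_nth[OF assms(2)])
  finally show ?thesis .
qed

lemma orbit_list_cycle_of_list:
  assumes "distinct xs" "xs \<noteq> []"
  shows "orbit_list (cycle_of_list xs) (hd xs) = xs"
proof -
  have "least_power (cycle_of_list xs) (hd xs) = length xs"
    unfolding least_power_def
  proof (rule Least_equality)
    show "(cycle_of_list xs ^^ length xs) (hd xs) = hd xs \<and> 0 < length xs"
      using assms cycle_of_list_nth[OF assms, of "length xs"] by (simp add: hd_conv_nth)
    fix k assume k: "(cycle_of_list xs ^^ k) (hd xs) = hd xs \<and> 0 < k"
    show "length xs \<le> k"
    proof (rule ccontr)
      assume "\<not> length xs \<le> k"
      with k cycle_of_list_nth[OF assms, of k] have "xs ! k = xs ! 0" "k < length xs"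
        using assms by (auto simp: hd_conv_nth)
      then show False using k assms nth_eq_iff_index_eq[of xs k 0] by auto
    qed
  qed
  then show ?thesis
    using cycle_of_list_nth[OF assms] by (auto intro!: nth_equalityI simp: orbit_list_def)
qed

lemma orbit_of_eq_orbit_list:
  assumes "\<sigma> permutes S" "finite S"
  shows "orbit_of \<sigma> i = set (orbit_list \<sigma> i)"
  using support_set[of \<sigma> i] assms permutation_permutes
  by (auto simp: orbit_of_def orbit_list_def)

lemma orbit_list_in_cycles_at:
  assumes "\<sigma> permutes S" "finite S" "i \<in> S"
  shows "orbit_list \<sigma> i \<in> cycles_at S i"
proof -
  have p: "permutation \<sigma>" using assms permutation_permutes by blast
  have "0 < least_power \<sigma> i" using least_power_of_permutation(2)[OF p] .
  moreover have "(\<sigma> ^^ k) i \<in> S" for k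
    using assms by (induction k) (auto simp: permutes_in_image)
  ultimately show ?thesis
    using cycle_of_permutation[OF p, of i] by (auto simp: cycles_at_def hd_map orbit_list_def)
qed

definition restr :: "nat set \<Rightarrow> (nat \<Rightarrow> nat) \<Rightarrow> nat \<Rightarrow> nat" where
  "restr T \<sigma> x = (if x \<in> T then \<sigma> x else x)"

lemma restr_permutes:
  assumes "\<sigma> permutes S" "finite S"
  shows "restr (S - set (orbit_list \<sigma> i)) \<sigma> permutes (S - set (orbit_list \<sigma> i))"
  using semidecomposition[OF assms(1) assms(2), of i]
  by (simp add: restr_def[abs_def] orbit_list_def)

lemma cycle_comp_restr:
  assumes "\<sigma> permutes S" "finite S"
  shows "cycle_of_list (orbit_list \<sigma> i) \<circ> restr (S - set (orbit_list \<sigma> i)) \<sigma> = \<sigma>"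
proof
  fix x
  let ?xs = "orbit_list \<sigma> i"
  have p: "permutation \<sigma>" using assms permutation_permutes by blast
  show "(cycle_of_list ?xs \<circ> restr (S - set ?xs) \<sigma>) x = \<sigma> x"
  proof (cases "x \<in> S - set ?xs")
    case True
    then have "restr (S - set ?xs) \<sigma> x = \<sigma> x" by (simp add: restr_def)
    moreover have "restr (S - set ?xs) \<sigma> x \<in> S - set ?xs"
      using restr_permutes[OF assms] True by (simp only: permutes_in_image)
    ultimately have "\<sigma> x \<notin> set ?xs" by simp
    then show ?thesis using True by (simp add: restr_def id_outside_supp)
  next
    case False
    then have r: "restr (S - set ?xs) \<sigma> x = x" unfolding restr_def by (rule if_not_P)
    show ?thesis
    proof (cases "x \<in> set ?xs")
      case True
      then show ?thesis using cycle_restrict[OF p, of x i] r by (simp add: orbit_list_def)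
    next
      case nx: False
      then have "x \<notin> S" using False by simp
      then have "\<sigma> x = x" using assms(1) by (simp add: permutes_not_in)
      then show ?thesis using id_outside_supp[OF nx] r by (simp only: o_apply)
    qed
  qed
qed

text \<open>The permutation \<tau> fixes \<open>set xs\<close> and preserves its complement in
  \<open>S\<close>, so the two factors move disjoint sets and each can be recovered from the
  composite.\<close>

lemma cycle_comp:
  assumes "finite S" and xs: "xs \<in> cycles_at S i" and \<tau>: "\<tau> permutes S - set xs"
  defines "\<sigma> \<equiv> cycle_of_list xs \<circ> \<tau>"
  shows "\<sigma> permutes S" "orbit_list \<sigma> i = xs" "restr (S - set xs) \<sigma> = \<tau>"
proof -
  have xs': "xs \<noteq> []" "hd xs = i" "distinct xs" "set xs \<subseteq> S"
    using xs by (auto simp: cycles_at_def)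
  have on: "\<sigma> x = cycle_of_list xs x" if "x \<in> set xs" for x
    using that permutes_not_in[OF \<tau>, of x] by (simp add: \<sigma>_def)
  have off: "\<sigma> x = \<tau> x" if "x \<in> S - set xs" for x
  proof -
    have "\<tau> x \<notin> set xs" using that permutes_in_image[OF \<tau>, of x] by auto
    then show ?thesis by (simp add: \<sigma>_def id_outside_supp)
  qed
  show "\<sigma> permutes S" unfolding \<sigma>_def
    by (rule permutes_compose) (use \<tau> xs' cycle_permutes[of xs] in \<open>auto intro: permutes_subset\<close>)
  have "(\<sigma> ^^ k) i = (cycle_of_list xs ^^ k) i" for k
    by (rule funpow_agree(1)[of _ "set xs"])
      (use on xs' permutes_in_image[OF cycle_permutes[of xs]] in auto)
  then have "orbit_list \<sigma> i = orbit_list (cycle_of_list xs) i" by (rule orbit_list_cong)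
  then show "orbit_list \<sigma> i = xs" using orbit_list_cycle_of_list[of xs] xs' by simp
  show "restr (S - set xs) \<sigma> = \<tau>"
    using off permutes_not_in[OF \<tau>] by (auto simp: restr_def fun_eq_iff)
qed

text \<open>By \<open>cycle_comp_restr\<close> and \<open>cycle_comp\<close>, a permutation and the
  pair of its cycle at \<open>i\<close> and the rest determine each other.\<close>

lemma sum_permutes_split_cycle:
  assumes "finite S" "i \<in> S"
  shows "(\<Sum>\<sigma> | \<sigma> permutes S. f (orbit_list \<sigma> i) (restr (S - set (orbit_list \<sigma> i)) \<sigma>)) =
    (\<Sum>xs\<in>cycles_at S i. \<Sum>\<tau> | \<tau> permutes S - set xs. f xs \<tau>)"
proof -
  have "(\<Sum>xs\<in>cycles_at S i. \<Sum>\<tau> | \<tau> permutes S - set xs. f xs \<tau>) =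
    (\<Sum>(xs, \<tau>)\<in>Sigma (cycles_at S i) (\<lambda>xs. {\<tau>. \<tau> permutes S - set xs}). f xs \<tau>)"
    by (rule sum.Sigma) (use assms in \<open>auto intro: finite_cycles_at finite_permutations\<close>)
  also have "\<dots> = (\<Sum>\<sigma> | \<sigma> permutes S. f (orbit_list \<sigma> i) (restr (S - set (orbit_list \<sigma> i)) \<sigma>))"
    by (rule sum.reindex_bij_witness[
        where j = "\<lambda>(xs, \<tau>). cycle_of_list xs \<circ> \<tau>"
          and i = "\<lambda>\<sigma>. (orbit_list \<sigma> i, restr (S - set (orbit_list \<sigma> i)) \<sigma>)"])
      (use assms cycle_comp[of S _ i] restr_permutes[of _ S i] orbit_list_in_cycles_at[of _ S i]
        cycle_comp_restr[of _ S i] in auto)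
  finally show ?thesis ..
qed

section \<open>Weights, leaders and signs after removal of a cycle\<close>

lemma cyc_prod_eq_cycle_wt:
  assumes "\<sigma> permutes S" "finite S"
  shows "cyc_prod F \<sigma> i = cycle_wt F (orbit_list \<sigma> i)"
proof -
  define L where "L = least_power \<sigma> i"
  have p: "permutation \<sigma>" using assms permutation_permutes by blast
  have L: "0 < L" "(\<sigma> ^^ L) i = i" using least_power_of_permutation[OF p] by (auto simp: L_def)
  have hd: "hd (orbit_list \<sigma> i) = i" using L by (simp add: orbit_list_def L_def hd_map)
  have len: "length (orbit_list \<sigma> i) = L" by (simp add: orbit_list_def L_def)
  have zs: "orbit_list \<sigma> i @ [hd (orbit_list \<sigma> i)] = map (\<lambda>k. (\<sigma> ^^ k) i) [0..<Suc L]"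
    unfolding hd using L by (simp add: L_def orbit_list_def)
  show ?thesis
    unfolding cycle_wt_def path_wt_nth zs cyc_prod_def cyc_len_eq_least_power L_def[symmetric]
    by (rule arg_cong[of _ _ prod_list], rule map_cong) (simp_all del: upt_Suc funpow.simps)
qed

lemma funpow_restr:
  assumes "\<sigma> permutes S" "finite S" "m \<in> S - set (orbit_list \<sigma> i)"
  shows "(restr (S - set (orbit_list \<sigma> i)) \<sigma> ^^ k) m = (\<sigma> ^^ k) m"
proof -
  let ?T = "S - set (orbit_list \<sigma> i)"
  have "restr ?T \<sigma> y \<in> ?T" if "y \<in> ?T" for y
    using that permutes_in_image[OF restr_permutes[OF assms(1,2), of i]] by blast
  then have "(\<sigma> ^^ k) m = (restr ?T \<sigma> ^^ k) m"
    by (intro funpow_agree(1)[of _ ?T] assms(3)) (auto simp: restr_def)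
  then show ?thesis by simp
qed

text \<open>One representative, the least element, for every cycle. Unlike \<open>leaders\<close>
  this singles out no orbit, so it describes what is left once a cycle has been removed.\<close>

definition cycle_mins :: "nat set \<Rightarrow> (nat \<Rightarrow> nat) \<Rightarrow> nat list" where
  "cycle_mins T \<tau> = sorted_list_of_set {m \<in> T. \<forall>k. m \<le> (\<tau> ^^ k) m}"

text \<open>In each cycle only the minimum lies below all its iterates, and \<open>Min T\<close>
  represents its own orbit and sorts first. This lets \<open>hdet_on\<close>, a column determinant
  at \<open>Min\<close>, be read as a sum of products over all cycles on an equal footing.\<close>

lemma cycle_mins_Min:
  assumes \<tau>: "\<tau> permutes T" and T: "finite T" "T \<noteq> {}"
  shows "cycle_mins T \<tau> = Min T # leaders T \<tau> (Min T)"
proof -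
  let ?A = "{m \<in> T. \<forall>k. m \<le> (\<tau> ^^ k) m}"
  have p: "permutation \<tau>" using \<tau> T permutation_permutes by blast
  have in_T: "(\<tau> ^^ k) m \<in> T" if "m \<in> T" for k m
    using that \<tau> by (induction k) (auto simp: permutes_in_image)
  have "Min T \<in> ?A" using T in_T by auto
  then have "Min ?A = Min T" using T by (intro Min_eqI) auto
  moreover have "?A - {Min T} = {m \<in> T. m \<notin> orbit_of \<tau> (Min T) \<and> (\<forall>k. m \<le> (\<tau> ^^ k) m)}"
  proof -
    \<comment> \<open>If \<open>m\<close> were in the orbit of \<open>Min T\<close>, then
      \<open>Min T\<close> would be an iterate of \<open>m\<close>, forcing
      \<open>m \<le> Min T\<close>.\<close>
    have "m \<notin> orbit_of \<tau> (Min T)" if m: "m \<in> T" "m \<noteq> Min T" "\<forall>k. m \<le> (\<tau> ^^ k) m" for m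
    proof
      assume "m \<in> orbit_of \<tau> (Min T)"
      then have "m \<in> set (orbit_list \<tau> (Min T))" using orbit_of_eq_orbit_list[OF \<tau> T(1)] by simp
      moreover have "Min T \<in> set (orbit_list \<tau> (Min T))"
        using orbit_list_in_cycles_at[OF \<tau> T(1)] T
        by (metis (mono_tags, lifting) Min_in cycles_at_def hd_in_set mem_Collect_eq)
      ultimately have "Min T \<in> set (orbit_list \<tau> m)"
        using disjoint_support'[OF p, of "Min T" m] disjoint_support'[OF p, of m "Min T"]
        unfolding orbit_list_def by blast
      then have "m \<le> Min T" using m(3) by (auto simp: orbit_list_def)
      then show False using m T by (simp add: order.antisym)
    qed
    moreover have "Min T \<in> orbit_of \<tau> (Min T)"
      unfolding orbit_of_def by (rule CollectI, rule exI[of _ 0]) simp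
    ultimately show ?thesis by auto
  qed
  ultimately show ?thesis
    unfolding cycle_mins_def leaders_def
    using sorted_list_of_set_nonempty[of ?A] \<open>Min T \<in> ?A\<close> T(1) by auto
qed

lemma leaders_eq_cycle_mins:
  assumes "\<sigma> permutes S" "finite S"
  shows "leaders S \<sigma> i = cycle_mins (S - set (orbit_list \<sigma> i)) (restr (S - set (orbit_list \<sigma> i)) \<sigma>)"
  unfolding leaders_def cycle_mins_def orbit_of_eq_orbit_list[OF assms]
  using funpow_restr[OF assms] by (intro arg_cong[of _ _ sorted_list_of_set]) auto

lemma cyc_prod_restr:
  assumes "\<sigma> permutes S" "finite S" "m \<in> S - set (orbit_list \<sigma> i)"
  shows "cyc_prod F \<sigma> m = cyc_prod F (restr (S - set (orbit_list \<sigma> i)) \<sigma>) m"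
  unfolding cyc_prod_def cyc_len_def
  by (simp only: funpow_restr[OF assms])

lemma set_cycle_mins: "finite T \<Longrightarrow> set (cycle_mins T \<tau>) \<subseteq> T"
  by (auto simp: cycle_mins_def)

lemma length_cycle_mins: "finite T \<Longrightarrow> length (cycle_mins T \<tau>) \<le> card T"
  by (simp add: cycle_mins_def card_mono)

definition perm_sign :: "nat set \<Rightarrow> (nat \<Rightarrow> nat) \<Rightarrow> quat" where
  "perm_sign T \<tau> = (- 1) ^ (card T - length (cycle_mins T \<tau>))"

text \<open>The row counterpart of \<open>hdet_on\<close>: what remains of \<open>rdet_on\<close>
  behind its leading cycle. Agreement with \<open>hdet_on\<close> in the Hermitian case is proved in
  \<open>rhdet_on_eq_hdet_on\<close>.\<close>

definition rhdet_on :: "nat set \<Rightarrow> quat mat \<Rightarrow> quat" where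
  "rhdet_on T F = (if T = {} then 1 else rdet_on T (Min T) F)"

text \<open>This form covers the empty set too: its only permutation is the identity, with sign 1
  and an empty product.\<close>

lemma hdet_on_eq:
  assumes "finite T"
  shows "hdet_on T F =
    (\<Sum>\<tau> | \<tau> permutes T. perm_sign T \<tau> * prod_list (map (cyc_prod F \<tau>) (rev (cycle_mins T \<tau>))))"
proof (cases "T = {}")
  case True
  then show ?thesis by (simp add: hdet_on_def perm_sign_def cycle_mins_def)
next
  case False
  then show ?thesis
    using assms by (auto simp: hdet_on_def cdet_on_def perm_sign_def cyc_sign_def cycle_mins_Min
      intro!: sum.cong)
qed

lemma rhdet_on_eq:
  assumes "finite T"
  shows "rhdet_on T F =
    (\<Sum>\<tau> | \<tau> permutes T. perm_sign T \<tau> * prod_list (map (cyc_prod F \<tau>) (cycle_mins T \<tau>)))"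
proof (cases "T = {}")
  case True
  then show ?thesis by (simp add: rhdet_on_def perm_sign_def cycle_mins_def)
next
  case False
  then show ?thesis
    using assms by (auto simp: rhdet_on_def rdet_on_def perm_sign_def cyc_sign_def cycle_mins_Min
      intro!: sum.cong)
qed

lemma cyc_sign_split:
  assumes \<sigma>: "\<sigma> permutes S" and S: "finite S" "i \<in> S"
  shows "cyc_sign S \<sigma> i = (- 1) ^ (length (orbit_list \<sigma> i) - 1) *
    perm_sign (S - set (orbit_list \<sigma> i)) (restr (S - set (orbit_list \<sigma> i)) \<sigma>)"
proof -
  let ?xs = "orbit_list \<sigma> i" and ?T = "S - set (orbit_list \<sigma> i)"
  have xs: "?xs \<noteq> []" "distinct ?xs" "set ?xs \<subseteq> S"
    using orbit_list_in_cycles_at[OF assms] by (auto simp: cycles_at_def)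
  have "card ?T = card S - length ?xs"
    using xs S by (simp add: card_Diff_subset distinct_card)
  moreover have "length ?xs \<le> card S"
    using xs S by (metis card_mono distinct_card)
  moreover have "length (leaders S \<sigma> i) \<le> card ?T"
    using leaders_eq_cycle_mins[OF \<sigma> S(1)] length_cycle_mins[of ?T] S by simp
  moreover have "0 < length ?xs" using xs by simp
  \<comment> \<open>Subtraction of naturals truncates, so the three bounds just collected are needed
    to split the exponent.\<close>
  ultimately have "card S - Suc (length (leaders S \<sigma> i)) =
      (length ?xs - 1) + (card ?T - length (leaders S \<sigma> i))"
    by linarith
  then show ?thesis
    unfolding cyc_sign_def perm_sign_def leaders_eq_cycle_mins[OF \<sigma> S(1), symmetric]
    by (simp only: power_add)
qed

section \<open>Cycle expansions of the two determinants\<close>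

lemma minus_one_power_commute: "(- 1) ^ k * x = x * (- 1 :: quat) ^ k"
  by (cases "even k") auto

text \<open>\<open>cdet_on\<close> puts the cycle through \<open>i\<close> last and the other
  leaders before it in reversed order, which is the order of \<open>hdet_on\<close> on the
  complement. Hence the sum over the remaining permutations factors out on the left.\<close>

lemma cdet_on_expand:
  assumes S: "finite S" "i \<in> S"
  shows "cdet_on S i F = (\<Sum>xs\<in>cycles_at S i.
    (- 1) ^ (length xs - 1) * hdet_on (S - set xs) F * cycle_wt F xs)"
proof -
  let ?f = "\<lambda>xs \<tau>. (- 1) ^ (length xs - 1) * (perm_sign (S - set xs) \<tau> *
    prod_list (map (cyc_prod F \<tau>) (rev (cycle_mins (S - set xs) \<tau>)))) * cycle_wt F xs"
  have "cdet_on S i F = (\<Sum>\<sigma> | \<sigma> permutes S. ?f (orbit_list \<sigma> i) (restr (S - set (orbit_list \<sigma> i)) \<sigma>))"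
    unfolding cdet_on_def
  proof (rule sum.cong[OF refl])
    fix \<sigma> assume "\<sigma> \<in> {\<sigma>. \<sigma> permutes S}"
    then have \<sigma>: "\<sigma> permutes S" by simp
    let ?T = "S - set (orbit_list \<sigma> i)"
    have eq: "cyc_prod F \<sigma> m = cyc_prod F (restr ?T \<sigma>) m"
      if "m \<in> set (cycle_mins ?T (restr ?T \<sigma>))" for m
      by (rule cyc_prod_restr[OF \<sigma> S(1)]) (use that set_cycle_mins[of ?T] S(1) in blast)
    have "map (cyc_prod F \<sigma>) (rev (leaders S \<sigma> i)) =
        map (cyc_prod F (restr ?T \<sigma>)) (rev (cycle_mins ?T (restr ?T \<sigma>)))"
      unfolding leaders_eq_cycle_mins[OF \<sigma> S(1)] using eq by (simp cong: map_cong)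
    then show "cyc_sign S \<sigma> i * prod_list (map (cyc_prod F \<sigma>) (rev (leaders S \<sigma> i) @ [i])) =
        ?f (orbit_list \<sigma> i) (restr ?T \<sigma>)"
      by (simp only: cyc_sign_split[OF \<sigma> S] cyc_prod_eq_cycle_wt[OF \<sigma> S(1)] map_append
          prod_list.append list.map prod_list.Cons prod_list.Nil mult.assoc mult_1_right)
  qed
  also have "\<dots> = (\<Sum>xs\<in>cycles_at S i. \<Sum>\<tau> | \<tau> permutes S - set xs. ?f xs \<tau>)"
    by (rule sum_permutes_split_cycle[OF S])
  finally show ?thesis
    using S by (simp add: hdet_on_eq sum_distrib_left sum_distrib_right)
qed

text \<open>Here the cycle through \<open>i\<close> comes first, so the complementary determinant
  stands on the right.\<close>

lemma rdet_on_expand: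
  assumes S: "finite S" "i \<in> S"
  shows "rdet_on S i F = (\<Sum>xs\<in>cycles_at S i.
    (- 1) ^ (length xs - 1) * cycle_wt F xs * rhdet_on (S - set xs) F)"
proof -
  let ?f = "\<lambda>xs \<tau>. (- 1) ^ (length xs - 1) * cycle_wt F xs * (perm_sign (S - set xs) \<tau> *
    prod_list (map (cyc_prod F \<tau>) (cycle_mins (S - set xs) \<tau>)))"
  have "rdet_on S i F = (\<Sum>\<sigma> | \<sigma> permutes S. ?f (orbit_list \<sigma> i) (restr (S - set (orbit_list \<sigma> i)) \<sigma>))"
    unfolding rdet_on_def
  proof (rule sum.cong[OF refl])
    fix \<sigma> assume "\<sigma> \<in> {\<sigma>. \<sigma> permutes S}"
    then have \<sigma>: "\<sigma> permutes S" by simp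
    let ?T = "S - set (orbit_list \<sigma> i)"
    have eq: "cyc_prod F \<sigma> m = cyc_prod F (restr ?T \<sigma>) m"
      if "m \<in> set (cycle_mins ?T (restr ?T \<sigma>))" for m
      by (rule cyc_prod_restr[OF \<sigma> S(1)]) (use that set_cycle_mins[of ?T] S(1) in blast)
    have "map (cyc_prod F \<sigma>) (leaders S \<sigma> i) =
        map (cyc_prod F (restr ?T \<sigma>)) (cycle_mins ?T (restr ?T \<sigma>))"
      unfolding leaders_eq_cycle_mins[OF \<sigma> S(1)] using eq by (simp cong: map_cong)
    \<comment> \<open>The cycle weight separates the sign of the remaining permutation from its
      product; only the sign may be moved past it.\<close>
    moreover have "perm_sign ?T (restr ?T \<sigma>) * (cycle_wt F (orbit_list \<sigma> i) * x) =
        cycle_wt F (orbit_list \<sigma> i) * (perm_sign ?T (restr ?T \<sigma>) * x)" for x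
      by (simp add: perm_sign_def minus_one_power_commute[of _ "cycle_wt F (orbit_list \<sigma> i)"]
          mult.assoc[symmetric])
    ultimately show "cyc_sign S \<sigma> i * prod_list (map (cyc_prod F \<sigma>) (i # leaders S \<sigma> i)) =
        ?f (orbit_list \<sigma> i) (restr ?T \<sigma>)"
      by (simp only: cyc_sign_split[OF \<sigma> S] cyc_prod_eq_cycle_wt[OF \<sigma> S(1)] list.map
          prod_list.Cons mult.assoc)
  qed
  also have "\<dots> = (\<Sum>xs\<in>cycles_at S i. \<Sum>\<tau> | \<tau> permutes S - set xs. ?f xs \<tau>)"
    by (rule sum_permutes_split_cycle[OF S])
  finally show ?thesis
    using S by (simp add: rhdet_on_eq sum_distrib_left)
qed

section \<open>Quaternions\<close>

lemma qcnj_simps [simp]: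
  "qcnj (x + y) = qcnj x + qcnj y" "qcnj (x - y) = qcnj x - qcnj y" "qcnj (- x) = - qcnj x"
  "qcnj (x * y) = qcnj y * qcnj x" "qcnj 0 = 0" "qcnj 1 = 1" "qcnj (qcnj x) = x"
  by (simp_all add: qcnj_def quat_eq_iff plus_quat_def minus_quat_def uminus_quat_def
      times_quat_def zero_quat_def one_quat_def algebra_simps)

lemma qRe_simps [simp]:
  "qRe (x + y) = qRe x + qRe y" "qRe (x - y) = qRe x - qRe y" "qRe (- x) = - qRe x"
  "qRe 0 = 0" "qRe 1 = 1" "qRe (qcnj x) = qRe x"
  by (simp_all add: qcnj_def plus_quat_def minus_quat_def uminus_quat_def zero_quat_def one_quat_def)

lemma qcnj_sum [simp]: "qcnj (sum f A) = (\<Sum>x\<in>A. qcnj (f x))"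
  by (induction A rule: infinite_finite_induct) auto

lemma qRe_sum [simp]: "qRe (sum f A) = (\<Sum>x\<in>A. qRe (f x))"
  by (induction A rule: infinite_finite_induct) auto

text \<open>The trace property behind the rotation invariance of the real part of a cycle
  weight.\<close>

lemma qRe_mult_commute: "qRe (x * y) = qRe (y * x)"
  by (simp add: times_quat_def)

lemma qRe_qcnj_mult_self: "qRe (qcnj x * x) = qnorm2 x"
  by (simp add: times_quat_def qcnj_def qnorm2_def power2_eq_square)

text \<open>Phrased through conjugation, so that a sum is real as soon as an involution of its index
  set conjugates the summands.\<close>

definition is_real :: "quat \<Rightarrow> bool" where
  "is_real x \<longleftrightarrow> qcnj x = x"

lemma is_real_iff: "is_real x \<longleftrightarrow> qI x = 0 \<and> qJ x = 0 \<and> qK x = 0"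
  by (auto simp: is_real_def qcnj_def quat_eq_iff)

lemma is_real_commute: "is_real x \<Longrightarrow> x * y = y * x"
  by (simp add: is_real_iff quat_eq_iff times_quat_def)

lemma is_real_left_commute:
  assumes "is_real c"
  shows "x * (c * y) = c * (x * y)"
  using is_real_commute[OF assms, of x] by (simp add: mult.assoc[symmetric])

lemma qcnj_real_mult: "is_real c \<Longrightarrow> qcnj (c * y) = c * qcnj y"
  using is_real_commute[of c "qcnj y"] by (simp add: is_real_def)

lemma qRe_mult_real: "is_real x \<Longrightarrow> qRe (x * y) = qRe x * qRe y"
  by (simp add: is_real_iff times_quat_def)

lemma is_real_eqI: "is_real x \<Longrightarrow> is_real y \<Longrightarrow> qRe x = qRe y \<Longrightarrow> x = y"
  by (simp add: is_real_iff quat_eq_iff)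

lemma is_real_intros [intro]:
  "is_real 0" "is_real 1" "is_real x \<Longrightarrow> is_real y \<Longrightarrow> is_real (x * y)"
  "is_real x \<Longrightarrow> is_real (- x)" "is_real x \<Longrightarrow> is_real (inverse x)"
  by (auto simp: is_real_iff times_quat_def zero_quat_def one_quat_def uminus_quat_def inverse_quat_def)

lemma is_real_sum [intro]: "(\<And>a. a \<in> A \<Longrightarrow> is_real (f a)) \<Longrightarrow> is_real (sum f A)"
  by (simp add: is_real_def)

lemma is_real_minus_one_power: "is_real ((- 1) ^ k)"
  by (cases "even k") auto

lemma qRe_minus_one_power_mult: "qRe ((- 1) ^ k * x) = (- 1) ^ k * qRe x"
  by (cases "even k") auto

section \<open>Hermitian determinants\<close>

lemma hdet_on_empty [simp]: "hdet_on {} F = 1" and rhdet_on_empty [simp]: "rhdet_on {} F = 1"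
  by (simp_all add: hdet_on_def rhdet_on_def)

text \<open>Both determinants unfold into cycle weights and smaller determinants inside
  \<open>T\<close>. The lemma serves \<open>replace_col\<close> and \<open>replace_row\<close>,
  which leave the complement of a cycle through the replaced index untouched.\<close>

lemma hdet_on_cong:
  assumes "finite T" "\<And>a b. a \<in> T \<Longrightarrow> b \<in> T \<Longrightarrow> F $$ (a, b) = G $$ (a, b)"
  shows "hdet_on T F = hdet_on T G" "rhdet_on T F = rhdet_on T G"
proof -
  have "hdet_on T F = hdet_on T G \<and> rhdet_on T F = rhdet_on T G"
    using assms
  proof (induction T rule: finite_psubset_induct)
    case (psubset T)
    show ?case
    proof (cases "T = {}")
      case False
      have "cycle_wt F xs = cycle_wt G xs \<and> hdet_on (T - set xs) F = hdet_on (T - set xs) G \<and>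
          rhdet_on (T - set xs) F = rhdet_on (T - set xs) G"
        if xs: "xs \<in> cycles_at T (Min T)" for xs
      proof -
        have "set (xs @ [hd xs]) \<subseteq> T" "T - set xs \<subset> T"
          using xs hd_in_set[of xs] by (auto simp: cycles_at_def)
        then show ?thesis
          using psubset.IH[of "T - set xs"] psubset.prems
          by (auto simp: cycle_wt_def intro!: path_wt_cong[of _ T])
      qed
      then show ?thesis
        using False psubset.hyps
        by (simp add: hdet_on_def[of T] rhdet_on_def[of T] cdet_on_expand rdet_on_expand)
    qed simp
  qed
  then show "hdet_on T F = hdet_on T G" "rhdet_on T F = rhdet_on T G" by auto
qed

section \<open>Independence of the index of expansion\<close>

lemma dropWhile_takeWhile_neq:
  assumes "k \<notin> set us"
  shows "dropWhile (\<lambda>x. x \<noteq> k) (us @ k # vs) = k # vs" "takeWhile (\<lambda>x. x \<noteq> k) (us @ k # vs) = us"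
  using assms by (induction us) auto

text \<open>A cycle through both indices can be listed from either of them, and \<open>h\<close>
  does not see the difference.\<close>

lemma rotation_reindex:
  assumes "\<And>us vs. h (us @ vs) = h (vs @ us)"
  shows "(\<Sum>xs | xs \<in> cycles_at S i \<and> k \<in> set xs. h xs) =
    (\<Sum>xs | xs \<in> cycles_at S k \<and> i \<in> set xs. h xs)"
proof -
  \<comment> \<open>\<open>rot k\<close> rotates a list to start at its first \<open>k\<close>; on a
    distinct list that starts at \<open>i\<close> and contains \<open>k\<close>,
    \<open>rot i\<close> undoes it.\<close>
  define rot :: "nat \<Rightarrow> nat list \<Rightarrow> nat list"
    where "rot k xs = dropWhile (\<lambda>x. x \<noteq> k) xs @ takeWhile (\<lambda>x. x \<noteq> k) xs" for k xs
  have split: "\<exists>us vs. xs = us @ k # vs \<and> k \<notin> set us \<and> rot k xs = k # vs @ us"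
    if k: "k \<in> set xs" for k xs
  proof -
    obtain us vs where "xs = us @ k # vs" "k \<notin> set us"
      using split_list_first[OF k] by blast
    moreover from this have "rot k xs = k # vs @ us"
      by (simp add: rot_def dropWhile_takeWhile_neq)
    ultimately show ?thesis by blast
  qed
  have *: "rot i (rot k xs) = xs \<and> rot k xs \<in> cycles_at S k \<and> i \<in> set (rot k xs) \<and> h (rot k xs) = h xs"
    if xs: "xs \<in> cycles_at S i" "k \<in> set xs" for i k xs
  proof -
    obtain us vs where us: "xs = us @ k # vs" "k \<notin> set us" "rot k xs = k # vs @ us"
      using split[OF xs(2)] by blast
    have d: "distinct xs" "hd xs = i" "set xs \<subseteq> S" "xs \<noteq> []" using xs by (auto simp: cycles_at_def)
    have "i \<in> set (rot k xs)" "set (rot k xs) = set xs" "distinct (rot k xs)"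
      using us d hd_in_set[of xs] by auto
    moreover have "h (rot k xs) = h xs" using us assms[of us "k # vs"] by simp
    moreover have "rot i (rot k xs) = xs"
    proof (cases us)
      case Nil
      then show ?thesis using us d by (simp add: rot_def)
    next
      case (Cons a us')
      then have a: "a = i" using us d by simp
      have "i \<notin> set (k # vs)" using us d Cons a by auto
      then show ?thesis
        using dropWhile_takeWhile_neq[of i "k # vs" us'] us(1,3) by (simp add: rot_def Cons a)
    qed
    ultimately show ?thesis using d us by (auto simp: cycles_at_def)
  qed
  show ?thesis
    by (rule sum.reindex_bij_witness[where i = "rot i" and j = "rot k"]) (use * in auto)
qed

text \<open>Cycles at \<open>i\<close> that pass through \<open>k\<close> are rotated to start at
  \<open>k\<close>. For those that avoid \<open>k\<close>, the complementary value \<open>D\<close>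
  is expanded at \<open>k\<close>, which yields a sum symmetric in the two cycles. The values are
  real numbers because only the real part of a cycle weight is invariant under rotation.\<close>

lemma cycle_expansion_symmetric:
  fixes D :: "nat set \<Rightarrow> real" and w :: "nat list \<Rightarrow> real"
  assumes S: "finite S" "i \<in> S" "k \<in> S"
    and w: "\<And>us vs. w (us @ vs) = w (vs @ us)"
    and D: "\<And>T j. T \<subset> S \<Longrightarrow> j \<in> T \<Longrightarrow>
      D T = (\<Sum>ys\<in>cycles_at T j. (- 1) ^ (length ys - 1) * D (T - set ys) * w ys)"
  shows "(\<Sum>xs\<in>cycles_at S i. (- 1) ^ (length xs - 1) * D (S - set xs) * w xs) =
    (\<Sum>xs\<in>cycles_at S k. (- 1) ^ (length xs - 1) * D (S - set xs) * w xs)"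
proof -
  let ?t = "\<lambda>xs. (- 1) ^ (length xs - 1) * D (S - set xs) * w xs"
  let ?u = "\<lambda>xs ys. (- 1) ^ (length xs - 1) * ((- 1) ^ (length ys - 1) * D (S - set xs - set ys) * w ys) * w xs"
  let ?X = "\<lambda>i k. {xs \<in> cycles_at S i. k \<notin> set xs}"
  have fin: "finite (cycles_at T a)" if "T \<subseteq> S" for T a
    using that S finite_cycles_at finite_subset by blast
  have split: "sum ?t (cycles_at S a) = sum ?t {xs. xs \<in> cycles_at S a \<and> b \<in> set xs} + sum ?t (?X a b)"
    for a b
  proof -
    have "cycles_at S a = {xs. xs \<in> cycles_at S a \<and> b \<in> set xs} \<union> ?X a b" by auto
    then show ?thesis
      using sum.union_disjoint[of "{xs. xs \<in> cycles_at S a \<and> b \<in> set xs}" "?X a b" ?t] fin[of S a]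
      by auto
  qed
  have expand: "sum ?t (?X a b) = (\<Sum>(xs, ys)\<in>Sigma (?X a b) (\<lambda>xs. cycles_at (S - set xs) b). ?u xs ys)"
    if "a \<in> S" "b \<in> S" for a b
  proof -
    have "?t xs = (\<Sum>ys\<in>cycles_at (S - set xs) b. ?u xs ys)" if xs: "xs \<in> ?X a b" for xs
    proof -
      have "S - set xs \<subset> S" "b \<in> S - set xs"
        using xs \<open>b \<in> S\<close> hd_in_set[of xs] by (auto simp: cycles_at_def)
      from D[OF this] show ?thesis by (simp add: sum_distrib_left sum_distrib_right)
    qed
    then have "sum ?t (?X a b) = (\<Sum>xs\<in>?X a b. \<Sum>ys\<in>cycles_at (S - set xs) b. ?u xs ys)" by simp
    also have "\<dots> = (\<Sum>(xs, ys)\<in>Sigma (?X a b) (\<lambda>xs. cycles_at (S - set xs) b). ?u xs ys)"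
      by (rule sum.Sigma) (use fin in auto)
    finally show ?thesis .
  qed
  \<comment> \<open>Both sides are sums over ordered pairs of disjoint cycles, one through
    \<open>i\<close> and one through \<open>k\<close>; exchanging the components matches
    them.\<close>
  have "sum ?t (?X i k) = sum ?t (?X k i)"
    unfolding expand[OF S(2,3)] expand[OF S(3,2)]
    by (rule sum.reindex_bij_witness[where i = "\<lambda>(x, y). (y, x)" and j = "\<lambda>(x, y). (y, x)"])
      (use S in \<open>auto simp: cycles_at_def Diff_eq Int_ac mult_ac\<close>)
  moreover have "sum ?t {xs. xs \<in> cycles_at S i \<and> k \<in> set xs} = sum ?t {xs. xs \<in> cycles_at S k \<and> i \<in> set xs}"
  proof (rule rotation_reindex)
    fix us vs :: "nat list"
    show "?t (us @ vs) = ?t (vs @ us)" using w[of us vs] by (simp add: add.commute Un_commute)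
  qed
  ultimately show ?thesis using split[of i k] split[of k i] by simp
qed

text \<open>Cutting the closed walk at the heads of \<open>us\<close> and \<open>vs\<close> gives
  two path weights, and rotation exchanges these two factors.\<close>

lemma qRe_cycle_wt_rotate: "qRe (cycle_wt F (us @ vs)) = qRe (cycle_wt F (vs @ us))"
proof (cases "us = [] \<or> vs = []")
  case False
  then obtain a us' b vs' where uv: "us = a # us'" "vs = b # vs'" by (meson neq_Nil_conv)
  have "cycle_wt F (us @ vs) = path_wt F (us @ [b]) * path_wt F (vs @ [a])"
    using path_wt_append[of F us b "vs' @ [a]"] by (simp add: cycle_wt_def uv)
  moreover have "cycle_wt F (vs @ us) = path_wt F (vs @ [a]) * path_wt F (us @ [b])"
    using path_wt_append[of F vs a "us' @ [b]"] by (simp add: cycle_wt_def uv)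
  ultimately show ?thesis using qRe_mult_commute by metis
qed auto

section \<open>Cofactors as sums over simple paths\<close>

definition paths_to :: "nat set \<Rightarrow> nat \<Rightarrow> nat list set" where
  "paths_to S j = {xs. xs \<noteq> [] \<and> last xs = j \<and> distinct xs \<and> set xs \<subseteq> S}"

text \<open>The cofactor: the coefficient of the entry \<open>b $ j\<close> in the column determinant
  at \<open>i\<close> of \<open>F\<close> with column \<open>i\<close> replaced by \<open>b\<close>.\<close>
definition cof :: "quat mat \<Rightarrow> nat set \<Rightarrow> nat \<Rightarrow> nat \<Rightarrow> quat" where
  "cof F S i j = (\<Sum>xs | xs \<in> paths_to S j \<and> hd xs = i.
    (- 1) ^ (length xs - 1) * hdet_on (S - set xs) F * path_wt F xs)"

lemma finite_paths_to: "finite S \<Longrightarrow> finite (paths_to S j)"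
  by (rule finite_subset[OF _ finite_subset_distinct[of S]]) (auto simp: paths_to_def)

lemma cof_outside:
  assumes "i \<notin> S \<or> j \<notin> S"
  shows "cof F S i j = 0"
proof -
  have "{xs. xs \<in> paths_to S j \<and> hd xs = i} = {}"
    using assms by (auto simp: paths_to_def dest: hd_in_set last_in_set)
  then show ?thesis by (simp only: cof_def sum.empty)
qed

lemma cof_diag:
  assumes "i \<in> S"
  shows "cof F S i i = hdet_on (S - {i}) F"
proof -
  have "{xs. xs \<in> paths_to S i \<and> hd xs = i} = {[i]}"
  proof (intro subset_antisym subsetI)
    fix xs assume xs: "xs \<in> {xs. xs \<in> paths_to S i \<and> hd xs = i}"
    then obtain ys where "xs = i # ys" by (cases xs) (auto simp: paths_to_def)
    with xs show "xs \<in> {[i]}" by (cases ys rule: rev_cases) (auto simp: paths_to_def)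
  qed (use assms in \<open>auto simp: paths_to_def\<close>)
  then show ?thesis by (simp add: cof_def)
qed

text \<open>Moving the head \<open>i\<close> of a cycle to the end gives a path that ends at
  \<open>i\<close>, with its start left free for grouping.\<close>

lemma rotate1_paths:
  "(\<Sum>xs\<in>cycles_at S i. h (rotate1 xs)) = (\<Sum>xs\<in>paths_to S i. h xs)"
proof -
  have 1: "xs \<in> cycles_at S i \<Longrightarrow> last (rotate1 xs) # butlast (rotate1 xs) = xs \<and> rotate1 xs \<in> paths_to S i" for xs
    by (cases xs) (auto simp: cycles_at_def paths_to_def)
  have 2: "xs \<in> paths_to S i \<Longrightarrow> rotate1 (last xs # butlast xs) = xs \<and> last xs # butlast xs \<in> cycles_at S i" for xs
    by (cases xs rule: rev_cases) (auto simp: cycles_at_def paths_to_def)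
  show ?thesis
    by (rule sum.reindex_bij_witness[where j = rotate1 and i = "\<lambda>xs. last xs # butlast xs"])
      (use 1 2 in auto)
qed

lemma cycle_wt_eq_path_wt_rotate1: "xs \<noteq> [] \<Longrightarrow> cycle_wt F xs = path_wt F (hd xs # rotate1 xs)"
  by (cases xs) (auto simp: cycle_wt_def)

lemma path_wt_Cons: "xs \<noteq> [] \<Longrightarrow> path_wt F (i # xs) = F $$ (i, hd xs) * path_wt F xs"
  by (cases xs) auto

lemma path_wt_snoc: "xs \<noteq> [] \<Longrightarrow> path_wt F (xs @ [i]) = path_wt F xs * F $$ (last xs, i)"
  using path_wt_append[of F "butlast xs" "last xs" "[i]"] by (cases xs rule: rev_cases) auto

lemma path_wt_replace_col:
  assumes "F \<in> carrier_mat n n" "set xs \<subseteq> {0..<n}" "i \<notin> set (tl xs)"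
  shows "path_wt (replace_col F i b) xs = path_wt F xs"
  using assms(2,3)
proof (induction xs)
  case (Cons a xs)
  then show ?case using assms(1) by (cases xs) (auto simp: replace_col_def)
qed simp

lemma path_wt_replace_row:
  assumes "F \<in> carrier_mat n n" "set xs \<subseteq> {0..<n}" "i \<notin> set (butlast xs)"
  shows "path_wt (replace_row F i b) xs = path_wt F xs"
  using assms(2,3)
proof (induction xs)
  case (Cons a xs)
  then show ?case using assms(1) by (cases xs) (auto simp: replace_row_def)
qed simp

text \<open>Only the closing step of a cycle at \<open>i\<close> enters column \<open>i\<close>, so
  the new column contributes the single right factor \<open>b $ last xs\<close>, while the
  complementary minor omits \<open>i\<close> and is unchanged. Grouping cycles by their last vertex
  gives the cofactors.\<close>

lemma cdet_on_replace_col: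
  assumes F: "F \<in> carrier_mat n n" and S: "S \<subseteq> {0..<n}" "i \<in> S"
  shows "cdet_on S i (replace_col F i b) = (\<Sum>k\<in>S. cof F S i k * b $ k)"
proof -
  have fin: "finite S" using S finite_subset by blast
  let ?G = "replace_col F i b"
  let ?t = "\<lambda>xs. (- 1) ^ (length xs - 1) * hdet_on (S - set xs) F * path_wt F xs"
  have "cdet_on S i ?G = (\<Sum>xs\<in>cycles_at S i. ?t xs * b $ last xs)"
    unfolding cdet_on_expand[OF fin S(2)]
  proof (rule sum.cong[OF refl])
    fix xs assume xs: "xs \<in> cycles_at S i"
    then have xs': "xs \<noteq> []" "hd xs = i" "distinct xs" "set xs \<subseteq> S" by (auto simp: cycles_at_def)
    have i: "i \<in> set xs" "i \<notin> set (tl xs)" using xs' by (cases xs; simp)+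
    have "hdet_on (S - set xs) ?G = hdet_on (S - set xs) F"
      using fin i F S by (intro hdet_on_cong) (auto simp: replace_col_def subset_iff)
    moreover have "cycle_wt ?G xs = path_wt F xs * b $ last xs"
    proof -
      have "last xs \<in> S" using xs' last_in_set[of xs] by blast
      then have "last xs < n" "i < n" using S by auto
      then have "?G $$ (last xs, i) = b $ last xs" using F by (simp add: replace_col_def)
      moreover have "path_wt ?G xs = path_wt F xs"
        using path_wt_replace_col[OF F] xs' S i by blast
      ultimately show ?thesis using xs' by (simp add: cycle_wt_def path_wt_snoc)
    qed
    ultimately show "(- 1) ^ (length xs - 1) * hdet_on (S - set xs) ?G * cycle_wt ?G xs = ?t xs * b $ last xs"
      by (simp add: mult.assoc)
  qed
  also have "\<dots> = (\<Sum>k\<in>S. \<Sum>xs | xs \<in> cycles_at S i \<and> last xs = k. ?t xs * b $ last xs)"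
    by (rule sum.group[symmetric]) (use fin finite_cycles_at in \<open>auto simp: cycles_at_def subset_iff\<close>)
  also have "\<dots> = (\<Sum>k\<in>S. cof F S i k * b $ k)"
  proof (rule sum.cong[OF refl])
    fix k
    have "{xs. xs \<in> cycles_at S i \<and> last xs = k} = {xs. xs \<in> paths_to S k \<and> hd xs = i}"
      by (auto simp: cycles_at_def paths_to_def)
    then show "(\<Sum>xs | xs \<in> cycles_at S i \<and> last xs = k. ?t xs * b $ last xs) = cof F S i k * b $ k"
      by (simp add: cof_def sum_distrib_right paths_to_def)
  qed
  finally show ?thesis .
qed

section \<open>Hermitian matrices: real determinants and Cramer's rule\<close>

locale hermitian =
  fixes F :: "quat mat" and n :: nat
  assumes carrier: "F \<in> carrier_mat n n"
    and herm: "\<And>i j. i < n \<Longrightarrow> j < n \<Longrightarrow> qcnj (F $$ (i, j)) = F $$ (j, i)"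
begin

text \<open>Conjugation reverses products, and the Hermitian condition reverses each edge.\<close>

lemma path_wt_rev: "set xs \<subseteq> {0..<n} \<Longrightarrow> path_wt F (rev xs) = qcnj (path_wt F xs)"
proof (induction xs)
  case (Cons a xs)
  show ?case
  proof (cases xs)
    case (Cons b ys)
    then have "path_wt F (rev (a # xs)) = path_wt F (rev xs) * path_wt F [b, a]"
      using path_wt_append[of F "rev ys" b "[a]"] by simp
    then show ?thesis using Cons Cons.IH Cons.prems by (simp add: herm)
  qed simp
qed simp

text \<open>The three claims need one common induction. Reality of the smaller minors makes them
  central, so that reversing a cycle conjugates its term and the row and column expansions agree.
  Expansion of the smaller minors at any index is the hypothesis of
  \<open>cycle_expansion_symmetric\<close>. Equality of real parts is then enough, since both sums
  are real.\<close>

lemma hdet_on_real_expand: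
  assumes "S \<subseteq> {0..<n}"
  shows "is_real (hdet_on S F) \<and> rhdet_on S F = hdet_on S F \<and>
    (\<forall>i\<in>S. hdet_on S F = (\<Sum>xs\<in>cycles_at S i.
      (- 1) ^ (length xs - 1) * hdet_on (S - set xs) F * cycle_wt F xs))"
proof -
  have "finite S" using assms finite_subset by blast
  then show ?thesis using assms
  proof (induction S rule: finite_psubset_induct)
    case (psubset S)
    show ?case
    proof (cases "S = {}")
      case True
      then show ?thesis by auto
    next
      case False
      define d where "d T = hdet_on T F" for T
      define t where "t xs = (- 1) ^ (length xs - 1) * d (S - set xs) * cycle_wt F xs" for xs
      have IH: "is_real (d T)" "rhdet_on T F = d T"
        "j \<in> T \<Longrightarrow> d T = (\<Sum>xs\<in>cycles_at T j. (- 1) ^ (length xs - 1) * d (T - set xs) * cycle_wt F xs)"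
        if "T \<subset> S" for T j
        using psubset.IH[OF that] psubset.prems that unfolding d_def by auto
      have sub: "S - set xs \<subset> S" if "xs \<in> cycles_at S i" for xs i
        using that hd_in_set[of xs] by (auto simp: cycles_at_def)
      have coeff_real: "is_real ((- 1) ^ (length xs - 1) * d (S - set xs))" if "xs \<in> cycles_at S i" for xs i
        using IH(1)[OF sub[OF that]] is_real_minus_one_power by blast
      have real: "is_real (sum t (cycles_at S i))" if i: "i \<in> S" for i
      proof -
        \<comment> \<open>The cycle traversed backwards, still starting from \<open>i\<close>; its
          complement and sign stay the same.\<close>
        define flip :: "nat list \<Rightarrow> nat list" where "flip xs = hd xs # rev (tl xs)" for xs
        have flip: "flip xs \<in> cycles_at S i \<and> flip (flip xs) = xs \<and> t (flip xs) = qcnj (t xs)"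
          if xs: "xs \<in> cycles_at S i" for xs
        proof -
          obtain ys where ys: "xs = i # ys" using xs by (cases xs) (auto simp: cycles_at_def)
          have "set (i # ys @ [i]) \<subseteq> {0..<n}" using xs psubset.prems ys by (auto simp: cycles_at_def)
          from path_wt_rev[OF this] have "cycle_wt F (flip xs) = qcnj (cycle_wt F xs)"
            by (simp add: cycle_wt_def flip_def ys)
          moreover have "set (flip xs) = set xs" "length (flip xs) = length xs" by (simp_all add: flip_def ys)
          moreover have "qcnj (t xs) = (- 1) ^ (length xs - 1) * d (S - set xs) * qcnj (cycle_wt F xs)"
            unfolding t_def by (rule qcnj_real_mult[OF coeff_real[OF xs]])
          ultimately show ?thesis using xs by (auto simp: t_def flip_def ys cycles_at_def)
        qed
        have "(\<Sum>xs\<in>cycles_at S i. qcnj (t xs)) = sum t (cycles_at S i)"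
          by (rule sum.reindex_bij_witness[where i = flip and j = flip]) (use flip in auto)
        then show ?thesis by (simp add: is_real_def)
      qed
      have qRe_t: "qRe (t xs) = (- 1) ^ (length xs - 1) * qRe (d (S - set xs)) * qRe (cycle_wt F xs)"
        if "xs \<in> cycles_at S i" for xs i
        using IH(1)[OF sub[OF that]] unfolding t_def
        by (simp add: mult.assoc qRe_minus_one_power_mult qRe_mult_real)
      \<comment> \<open>Real parts are commuting numbers and invariant under rotation of the cycle,
        as \<open>cycle_expansion_symmetric\<close> requires.\<close>
      have "qRe (sum t (cycles_at S i)) = qRe (sum t (cycles_at S k))" if "i \<in> S" "k \<in> S" for i k
      proof -
        have "(\<Sum>xs\<in>cycles_at S i. (- 1) ^ (length xs - 1) * qRe (d (S - set xs)) * qRe (cycle_wt F xs)) =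
            (\<Sum>xs\<in>cycles_at S k. (- 1) ^ (length xs - 1) * qRe (d (S - set xs)) * qRe (cycle_wt F xs))"
        proof (rule cycle_expansion_symmetric[OF psubset.hyps that])
          fix T j assume T: "T \<subset> S" "j \<in> T"
          have "T - set xs \<subset> S" for xs using T by auto
          then show "qRe (d T) = (\<Sum>ys\<in>cycles_at T j.
              (- 1) ^ (length ys - 1) * qRe (d (T - set ys)) * qRe (cycle_wt F ys))"
            unfolding IH(3)[OF T]
            by (simp add: IH(1) mult.assoc qRe_minus_one_power_mult qRe_mult_real)
        qed (rule qRe_cycle_wt_rotate)
        then show ?thesis by (simp add: qRe_t)
      qed
      then have indep: "sum t (cycles_at S i) = sum t (cycles_at S k)" if "i \<in> S" "k \<in> S" for i k
        using that real is_real_eqI by blast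
      have m: "Min S \<in> S" using False psubset.hyps by simp
      have dS: "d S = sum t (cycles_at S (Min S))"
        using False by (simp add: d_def t_def hdet_on_def[of S] cdet_on_expand[OF psubset.hyps m])
      have "rhdet_on S F = sum t (cycles_at S (Min S))"
        unfolding rhdet_on_def[of S] rdet_on_expand[OF psubset.hyps m] if_not_P[OF False]
      proof (rule sum.cong[OF refl])
        fix xs assume xs: "xs \<in> cycles_at S (Min S)"
        show "(- 1) ^ (length xs - 1) * cycle_wt F xs * rhdet_on (S - set xs) F = t xs"
          using is_real_commute[OF IH(1)[OF sub[OF xs]], of "cycle_wt F xs"]
          by (simp add: t_def IH(2)[OF sub[OF xs]] mult.assoc)
      qed
      then show ?thesis
        using dS real[OF m] indep[OF m] unfolding d_def[symmetric] t_def[symmetric] by auto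
    qed
  qed
qed

lemma hdet_on_real: "S \<subseteq> {0..<n} \<Longrightarrow> is_real (hdet_on S F)"
  and rhdet_on_eq_hdet_on: "S \<subseteq> {0..<n} \<Longrightarrow> rhdet_on S F = hdet_on S F"
  and hdet_on_expand: "S \<subseteq> {0..<n} \<Longrightarrow> i \<in> S \<Longrightarrow> hdet_on S F = (\<Sum>xs\<in>cycles_at S i.
      (- 1) ^ (length xs - 1) * hdet_on (S - set xs) F * cycle_wt F xs)"
  using hdet_on_real_expand by blast+

lemma hdet_on_commute: "S \<subseteq> {0..<n} \<Longrightarrow> hdet_on S F * x = x * hdet_on S F"
  using hdet_on_real is_real_commute by blast

lemma coeff_commute:
  assumes "S \<subseteq> {0..<n}"
  shows "x * ((- 1) ^ k * hdet_on S F * y) = (- 1) ^ k * hdet_on S F * (x * y)"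
  using hdet_on_real[OF assms] is_real_minus_one_power by (intro is_real_left_commute) blast

text \<open>Reversal exchanges the paths from \<open>i\<close> to \<open>j\<close> with those from
  \<open>j\<close> to \<open>i\<close> and conjugates their weights; the coefficients are
  real.\<close>

lemma qcnj_cof:
  assumes S: "S \<subseteq> {0..<n}"
  shows "qcnj (cof F S i j) = cof F S j i"
proof -
  let ?t = "\<lambda>xs. (- 1) ^ (length xs - 1) * hdet_on (S - set xs) F * path_wt F xs"
  have "(\<Sum>xs | xs \<in> paths_to S j \<and> hd xs = i. qcnj (?t xs)) =
      (\<Sum>xs | xs \<in> paths_to S i \<and> hd xs = j. ?t xs)"
  proof (rule sum.reindex_bij_witness[where i = rev and j = rev])
    fix xs assume xs: "xs \<in> {xs. xs \<in> paths_to S j \<and> hd xs = i}"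
    have "S - set xs \<subseteq> {0..<n}" "set xs \<subseteq> {0..<n}" using S xs by (auto simp: paths_to_def)
    then have "is_real ((- 1) ^ (length xs - 1) * hdet_on (S - set xs) F)" "path_wt F (rev xs) = qcnj (path_wt F xs)"
      using hdet_on_real is_real_minus_one_power path_wt_rev by blast+
    then show "?t (rev xs) = qcnj (?t xs)"
      by (simp only: qcnj_real_mult length_rev set_rev)
  qed (auto simp: paths_to_def hd_rev last_rev)
  then show ?thesis by (simp add: cof_def)
qed

text \<open>Only the opening step of a cycle at \<open>i\<close> leaves row \<open>i\<close>. The
  rest of the cycle, listed by \<open>rotate1\<close>, is a path ending at \<open>i\<close>, and the
  complementary minor, being real, moves from the right end to its place in
  \<open>cof\<close>.\<close>

lemma rdet_on_replace_row:
  assumes S: "S \<subseteq> {0..<n}" "i \<in> S"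
  shows "rdet_on S i (replace_row F i b) = (\<Sum>k\<in>S. b $ k * cof F S k i)"
proof -
  have fin: "finite S" using S finite_subset by blast
  let ?G = "replace_row F i b"
  let ?t = "\<lambda>xs. (- 1) ^ (length xs - 1) * hdet_on (S - set xs) F * path_wt F xs"
  have "rdet_on S i ?G = (\<Sum>xs\<in>cycles_at S i. b $ hd (rotate1 xs) * ?t (rotate1 xs))"
    unfolding rdet_on_expand[OF fin S(2)]
  proof (rule sum.cong[OF refl])
    fix xs assume xs: "xs \<in> cycles_at S i"
    let ?ys = "rotate1 xs"
    have xs': "xs \<noteq> []" "hd xs = i" "distinct xs" "set xs \<subseteq> S" using xs by (auto simp: cycles_at_def)
    have i: "i \<in> set xs" "i \<notin> set (butlast ?ys)" using xs' by (cases xs; simp)+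
    have "rhdet_on (S - set xs) ?G = rhdet_on (S - set xs) F"
      using fin i carrier S by (intro hdet_on_cong) (auto simp: replace_row_def subset_iff)
    moreover have "rhdet_on (S - set xs) F = hdet_on (S - set xs) F"
      using S by (intro rhdet_on_eq_hdet_on) auto
    moreover have "cycle_wt ?G xs = b $ hd ?ys * path_wt F ?ys"
    proof -
      have ys: "?ys \<noteq> []" "set ?ys \<subseteq> S" using xs' by auto
      have "hd ?ys < n" "i < n" using ys hd_in_set[of ?ys] S by auto
      then have "?G $$ (i, hd ?ys) = b $ hd ?ys" using carrier by (simp add: replace_row_def)
      moreover have "path_wt ?G ?ys = path_wt F ?ys"
        using path_wt_replace_row[OF carrier] ys S i by blast
      ultimately show ?thesis using xs' ys by (simp add: cycle_wt_eq_path_wt_rotate1 path_wt_Cons)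
    qed
    moreover have "S - set xs \<subseteq> {0..<n}" using S by auto
    ultimately show "(- 1) ^ (length xs - 1) * cycle_wt ?G xs * rhdet_on (S - set xs) ?G =
        b $ hd ?ys * ?t ?ys"
      using coeff_commute hdet_on_commute by (simp add: mult.assoc)
  qed
  also have "\<dots> = (\<Sum>xs\<in>paths_to S i. b $ hd xs * ?t xs)"
    by (rule rotate1_paths)
  also have "\<dots> = (\<Sum>k\<in>S. \<Sum>xs | xs \<in> paths_to S i \<and> hd xs = k. b $ hd xs * ?t xs)"
    by (rule sum.group[symmetric]) (use fin finite_paths_to in \<open>auto simp: paths_to_def subset_iff\<close>)
  also have "\<dots> = (\<Sum>k\<in>S. b $ k * cof F S k i)"
    by (simp add: cof_def sum_distrib_left)
  finally show ?thesis .
qed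

text \<open>The walk \<open>i # xs\<close> takes one step from \<open>i\<close> into
  \<open>S\<close> and then follows a simple path to \<open>j\<close>. For \<open>i \<in> S\<close>
  the walk may come back to \<open>i\<close>; for \<open>i \<notin> S\<close> it is a simple path in
  \<open>insert i S\<close>.\<close>

definition walk_sum :: "nat set \<Rightarrow> nat \<Rightarrow> nat \<Rightarrow> quat" where
  "walk_sum S i j = (\<Sum>xs\<in>paths_to S j.
    (- 1) ^ (length xs - 1) * hdet_on (S - set xs) F * path_wt F (i # xs))"

lemma row_times_cof:
  assumes S: "S \<subseteq> {0..<n}"
  shows "(\<Sum>l\<in>S. F $$ (i, l) * cof F S l j) = walk_sum S i j"
proof -
  have fin: "finite S" using S finite_subset by blast
  let ?t = "\<lambda>xs. (- 1) ^ (length xs - 1) * hdet_on (S - set xs) F * path_wt F xs"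
  have "walk_sum S i j = (\<Sum>xs\<in>paths_to S j. F $$ (i, hd xs) * ?t xs)"
    unfolding walk_sum_def
  proof (rule sum.cong[OF refl])
    fix xs assume "xs \<in> paths_to S j"
    then have "xs \<noteq> []" "S - set xs \<subseteq> {0..<n}" using S by (auto simp: paths_to_def)
    then show "(- 1) ^ (length xs - 1) * hdet_on (S - set xs) F * path_wt F (i # xs) = F $$ (i, hd xs) * ?t xs"
      by (simp add: path_wt_Cons coeff_commute)
  qed
  also have "\<dots> = (\<Sum>l\<in>S. \<Sum>xs | xs \<in> paths_to S j \<and> hd xs = l. F $$ (i, hd xs) * ?t xs)"
    by (rule sum.group[symmetric]) (use fin finite_paths_to in \<open>auto simp: paths_to_def subset_iff\<close>)
  also have "\<dots> = (\<Sum>l\<in>S. F $$ (i, l) * cof F S l j)"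
    by (simp add: cof_def sum_distrib_left)
  finally show ?thesis ..
qed

text \<open>Prefixing \<open>i\<close> turns the paths in \<open>S\<close> to \<open>j\<close> into
  the paths from \<open>i\<close> to \<open>j\<close> in \<open>insert i S\<close>, with the same
  complement and one more vertex, hence the opposite sign. For \<open>i = j\<close> no path in
  \<open>S\<close> ends at \<open>j\<close> and only the diagonal cofactor is left. This links the
  orders \<open>k\<close> and \<open>Suc k\<close>.\<close>

lemma cof_insert:
  assumes i: "i \<notin> S"
  shows "cof F (insert i S) i j = (if i = j then hdet_on S F else 0) - walk_sum S i j"
proof (cases "i = j")
  case True
  have "paths_to S j = {}" using True i by (auto simp: paths_to_def dest: last_in_set)
  then show ?thesis using True i cof_diag[of i "insert i S" F] by (simp add: walk_sum_def)
next
  case False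
  have paths: "{xs. xs \<in> paths_to (insert i S) j \<and> hd xs = i} = (#) i ` paths_to S j"
  proof (intro subset_antisym subsetI)
    fix xs assume xs: "xs \<in> {xs. xs \<in> paths_to (insert i S) j \<and> hd xs = i}"
    then obtain ys where ys: "xs = i # ys" by (cases xs) (auto simp: paths_to_def)
    have "ys \<in> paths_to S j" using xs ys False by (auto simp: paths_to_def split: if_splits)
    then show "xs \<in> (#) i ` paths_to S j" using ys by blast
  qed (use i in \<open>auto simp: paths_to_def\<close>)
  have "cof F (insert i S) i j = (\<Sum>xs\<in>paths_to S j.
      (- 1) ^ length xs * hdet_on (S - set xs) F * path_wt F (i # xs))"
    unfolding cof_def paths
  proof (subst sum.reindex, simp add: inj_on_def, rule sum.cong[OF refl])
    fix xs assume "xs \<in> paths_to S j"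
    then have "insert i S - set (i # xs) = S - set xs" using i by (auto simp: paths_to_def)
    then show "((\<lambda>xs. (- 1) ^ (length xs - 1) * hdet_on (insert i S - set xs) F * path_wt F xs) \<circ> (#) i) xs =
        (- 1) ^ length xs * hdet_on (S - set xs) F * path_wt F (i # xs)" by simp
  qed
  also have "\<dots> = - walk_sum S i j"
    unfolding walk_sum_def sum_negf[symmetric]
  proof (rule sum.cong[OF refl])
    fix xs assume "xs \<in> paths_to S j"
    then obtain k where "length xs = Suc k" by (cases xs) (auto simp: paths_to_def)
    then show "(- 1) ^ length xs * hdet_on (S - set xs) F * path_wt F (i # xs) =
        - ((- 1) ^ (length xs - 1) * hdet_on (S - set xs) F * path_wt F (i # xs))" by simp
  qed
  finally show ?thesis using False by simp
qed

text \<open>A walk from \<open>i\<close> that returns to \<open>i\<close> splits off a cycle; expanding the complementary minor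
  along that cycle cancels it against the walks that avoid \<open>i\<close>.\<close>
lemma walk_sum_off_diag:
  assumes S: "S \<subseteq> {0..<n}" "i \<in> S" "i \<noteq> j"
  shows "walk_sum S i j = 0"
proof -
  have fin: "finite S" using S finite_subset by blast
  let ?t = "\<lambda>xs. (- 1) ^ (length xs - 1) * hdet_on (S - set xs) F * path_wt F (i # xs)"
  let ?A = "paths_to (S - {i}) j" and ?B = "{xs \<in> paths_to S j. i \<in> set xs}"
  have "paths_to S j = ?A \<union> ?B" "?A \<inter> ?B = {}" by (auto simp: paths_to_def)
  then have "walk_sum S i j = sum ?t ?A + sum ?t ?B"
    unfolding walk_sum_def using sum.union_disjoint[of ?A ?B ?t] fin by (simp add: finite_paths_to)
  \<comment> \<open>With \<open>xs = us @ i # P\<close>, the walk \<open>i # xs\<close> runs round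
    the cycle \<open>c = i # us\<close> and then along \<open>i # P\<close>. The list
    \<open>xs\<close> is distinct, so \<open>i\<close> occurs in it once and the splitting is
    unique.\<close>
  moreover have "sum ?t ?B = (\<Sum>(P, c)\<in>Sigma ?A (\<lambda>P. cycles_at (S - set P) i). ?t (tl c @ i # P))"
  proof (rule sum.reindex_bij_witness[where i = "\<lambda>(P, c). tl c @ i # P"
        and j = "\<lambda>xs. (tl (dropWhile (\<lambda>x. x \<noteq> i) xs), i # takeWhile (\<lambda>x. x \<noteq> i) xs)"])
    fix xs assume xs: "xs \<in> ?B"
    then obtain us vs where us: "xs = us @ i # vs" "i \<notin> set us"
      by (metis (mono_tags, lifting) mem_Collect_eq split_list_first)
    note dw = dropWhile_takeWhile_neq[OF us(2), of vs, folded us(1)]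
    show "(case (tl (dropWhile (\<lambda>x. x \<noteq> i) xs), i # takeWhile (\<lambda>x. x \<noteq> i) xs) of (P, c) \<Rightarrow> tl c @ i # P) = xs"
      unfolding dw by (simp add: us(1))
    show "(case (tl (dropWhile (\<lambda>x. x \<noteq> i) xs), i # takeWhile (\<lambda>x. x \<noteq> i) xs) of (P, c) \<Rightarrow> ?t (tl c @ i # P)) = ?t xs"
      unfolding dw by (simp add: us(1))
    show "(tl (dropWhile (\<lambda>x. x \<noteq> i) xs), i # takeWhile (\<lambda>x. x \<noteq> i) xs) \<in> Sigma ?A (\<lambda>P. cycles_at (S - set P) i)"
      using xs S unfolding dw unfolding us(1) by (auto simp: paths_to_def cycles_at_def split: if_splits)
  next
    fix a assume a: "a \<in> Sigma ?A (\<lambda>P. cycles_at (S - set P) i)"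
    then obtain P c where a': "a = (P, c)" "P \<in> ?A" "c \<in> cycles_at (S - set P) i" by blast
    then obtain ys where c: "c = i # ys" "i \<notin> set ys" by (cases c) (auto simp: cycles_at_def)
    note dw = dropWhile_takeWhile_neq[OF c(2), of P]
    show "(tl (dropWhile (\<lambda>x. x \<noteq> i) (case a of (P, c) \<Rightarrow> tl c @ i # P)),
        i # takeWhile (\<lambda>x. x \<noteq> i) (case a of (P, c) \<Rightarrow> tl c @ i # P)) = a"
      by (simp add: a' c dw)
    show "(case a of (P, c) \<Rightarrow> tl c @ i # P) \<in> ?B"
      using a' c S by (auto simp: paths_to_def cycles_at_def)
  qed
  also have "\<dots> = (\<Sum>P\<in>?A. \<Sum>c\<in>cycles_at (S - set P) i. ?t (tl c @ i # P))"
    by (rule sum.Sigma[symmetric]) (use fin in \<open>auto intro: finite_paths_to finite_cycles_at\<close>)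
  also have "\<dots> = (\<Sum>P\<in>?A. - ?t P)"
  proof (rule sum.cong[OF refl])
    fix P assume P: "P \<in> ?A"
    let ?T = "S - set P"
    have T: "?T \<subseteq> {0..<n}" "i \<in> ?T" using P S by (auto simp: paths_to_def)
    have "?t (tl c @ i # P) = (- 1) ^ length P * ((- 1) ^ (length c - 1) * hdet_on (?T - set c) F * cycle_wt F c) *
        path_wt F (i # P)" if c: "c \<in> cycles_at ?T i" for c
    proof -
      obtain ys where ys: "c = i # ys" using c by (cases c) (auto simp: cycles_at_def)
      have "S - set (tl c @ i # P) = ?T - set c" using ys by auto
      moreover have "path_wt F (i # tl c @ i # P) = cycle_wt F c * path_wt F (i # P)"
        using path_wt_append[of F c i P] by (simp add: ys cycle_wt_def)
      moreover have "(- 1 :: quat) ^ (length (tl c @ i # P) - 1) = (- 1) ^ length P * (- 1) ^ (length c - 1)"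
        by (simp add: ys power_add[symmetric] add.commute)
      ultimately show ?thesis by (simp add: mult.assoc)
    qed
    \<comment> \<open>Summed over \<open>c\<close>, the middle factor is the expansion of
      \<open>hdet_on ?T F\<close> at \<open>i\<close>. The exponent is \<open>length P\<close> where
      \<open>?t P\<close> has \<open>length P - 1\<close>, which supplies the cancelling
      sign.\<close>
    then have "(\<Sum>c\<in>cycles_at ?T i. ?t (tl c @ i # P)) = (- 1) ^ length P * hdet_on ?T F * path_wt F (i # P)"
      by (simp add: sum_distrib_left[symmetric] sum_distrib_right[symmetric] hdet_on_expand[OF T])
    moreover obtain k where "length P = Suc k" using P by (cases P) (auto simp: paths_to_def)
    ultimately show "(\<Sum>c\<in>cycles_at ?T i. ?t (tl c @ i # P)) = - ?t P" by simp
  qed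
  also have "\<dots> = - sum ?t ?A" by (rule sum_negf)
  ultimately show ?thesis by simp
qed

text \<open>For \<open>i = j\<close> the walks from \<open>i\<close> back to \<open>i\<close> are
  the cycles at \<open>i\<close>, so their sum is the cycle expansion of the determinant.\<close>

lemma row_times_cof_eq:
  assumes S: "S \<subseteq> {0..<n}" "i \<in> S"
  shows "(\<Sum>l\<in>S. F $$ (i, l) * cof F S l j) = (if i = j then hdet_on S F else 0)"
proof (cases "i = j")
  case True
  have "hdet_on S F = (\<Sum>xs\<in>cycles_at S i. (- 1) ^ (length (rotate1 xs) - 1) *
      hdet_on (S - set (rotate1 xs)) F * path_wt F (i # rotate1 xs))"
    unfolding hdet_on_expand[OF S]
    by (rule sum.cong[OF refl]) (auto simp: cycles_at_def cycle_wt_eq_path_wt_rotate1)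
  also have "\<dots> = walk_sum S i i"
    unfolding walk_sum_def by (rule rotate1_paths)
  finally show ?thesis using True by (simp add: row_times_cof[OF S(1)])
next
  case False
  then show ?thesis by (simp add: row_times_cof[OF S(1)] walk_sum_off_diag[OF S])
qed

end

section \<open>The sums of cofactors of a given order\<close>

definition cof_mat :: "quat mat \<Rightarrow> nat \<Rightarrow> nat \<Rightarrow> quat mat" where
  "cof_mat F n k = mat n n (\<lambda>(i, j). \<Sum>\<beta>\<in>Lset k n. cof F \<beta> i j)"

definition minor_sum :: "quat mat \<Rightarrow> nat \<Rightarrow> nat \<Rightarrow> quat" where
  "minor_sum F n k = (\<Sum>\<beta>\<in>Lset k n. hdet_on \<beta> F)"

lemma cof_mat_carrier: "cof_mat F n k \<in> carrier_mat n n"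
  by (simp add: cof_mat_def)

lemma finite_Lset: "finite (Lset k n)"
  by (rule finite_subset[of _ "Pow {0..<n}"]) (auto simp: Lset_def)

lemma LsetD: "\<beta> \<in> Lset k n \<Longrightarrow> \<beta> \<subseteq> {0..<n} \<and> finite \<beta> \<and> card \<beta> = k"
  by (auto simp: Lset_def intro: finite_subset)

lemma mult_mat_index:
  assumes "A \<in> carrier_mat m n" "B \<in> carrier_mat n p" "i < m" "j < p"
  shows "(A * B) $$ (i, j) = (\<Sum>k<n. A $$ (i, k) * B $$ (k, j))"
  using assms by (simp add: scalar_prod_def atLeast0LessThan)

context hermitian
begin

lemma sum_cof_outside:
  assumes "S \<subseteq> {0..<n}"
  shows "(\<Sum>l<n. g l * cof F S l j) = (\<Sum>l\<in>S. g l * cof F S l j)"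
    "(\<Sum>l<n. cof F S j l * g l) = (\<Sum>l\<in>S. cof F S j l * g l)"
  by (rule sum.mono_neutral_right; use assms cof_outside in auto)+

text \<open>An index set that contains \<open>i\<close> contributes by Cramer's rule; one that omits
  \<open>i\<close> contributes, in addition, minus the cofactor of \<open>insert i \<beta>\<close>.
  Adding \<open>i\<close> is a bijection onto the sets of order \<open>Suc k\<close> containing
  \<open>i\<close>, and all other sets of that order have zero cofactors in row
  \<open>i\<close>.\<close>

lemma cof_mat_Suc_index:
  assumes i: "i < n"
  shows "(\<Sum>\<beta>\<in>Lset (Suc k) n. cof F \<beta> i j) + (\<Sum>l<n. F $$ (i, l) * (\<Sum>\<beta>\<in>Lset k n. cof F \<beta> l j)) =
    (if i = j then minor_sum F n k else 0)"
proof -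
  define \<delta> where "\<delta> \<beta> = (if i = j then hdet_on \<beta> F else 0)" for \<beta>
  have "(\<Sum>l<n. F $$ (i, l) * (\<Sum>\<beta>\<in>Lset k n. cof F \<beta> l j)) =
      (\<Sum>\<beta>\<in>Lset k n. \<Sum>l<n. F $$ (i, l) * cof F \<beta> l j)"
    unfolding sum_distrib_left by (rule sum.swap)
  also have "\<dots> = (\<Sum>\<beta>\<in>Lset k n. \<delta> \<beta> - (if i \<in> \<beta> then 0 else cof F (insert i \<beta>) i j))"
  proof (rule sum.cong[OF refl])
    fix \<beta> assume "\<beta> \<in> Lset k n"
    then have \<beta>: "\<beta> \<subseteq> {0..<n}" using LsetD by blast
    show "(\<Sum>l<n. F $$ (i, l) * cof F \<beta> l j) = \<delta> \<beta> - (if i \<in> \<beta> then 0 else cof F (insert i \<beta>) i j)"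
    proof (cases "i \<in> \<beta>")
      case True
      then show ?thesis by (simp add: sum_cof_outside[OF \<beta>] row_times_cof_eq[OF \<beta> True] \<delta>_def)
    next
      case False
      then show ?thesis
        by (simp add: sum_cof_outside[OF \<beta>] row_times_cof[OF \<beta>] cof_insert[OF False] \<delta>_def)
    qed
  qed
  also have "\<dots> = (\<Sum>\<beta>\<in>Lset k n. \<delta> \<beta>) - (\<Sum>\<beta> | \<beta> \<in> Lset k n \<and> i \<notin> \<beta>. cof F (insert i \<beta>) i j)"
    unfolding sum_subtractf
    by (simp add: sum.If_cases[OF finite_Lset] Int_def)
  also have "(\<Sum>\<beta> | \<beta> \<in> Lset k n \<and> i \<notin> \<beta>. cof F (insert i \<beta>) i j) =
      (\<Sum>\<beta> | \<beta> \<in> Lset (Suc k) n \<and> i \<in> \<beta>. cof F \<beta> i j)"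
    by (rule sum.reindex_bij_witness[where i = "\<lambda>\<beta>. \<beta> - {i}" and j = "insert i"])
      (use i in \<open>auto simp: Lset_def insert_absorb card_insert_if finite_subset\<close>)
  also have "\<dots> = (\<Sum>\<beta>\<in>Lset (Suc k) n. cof F \<beta> i j)"
    by (rule sum.mono_neutral_left) (use finite_Lset cof_outside in auto)
  finally show ?thesis by (simp add: \<delta>_def minor_sum_def)
qed

lemma qadj_cof_mat: "qadj (cof_mat F n k) = cof_mat F n k"
  by (rule eq_matI) (auto simp: qadj_def cof_mat_def qcnj_cof LsetD intro!: sum.cong)

lemma minor_sum_real: "is_real (minor_sum F n k)"
  unfolding minor_sum_def using hdet_on_real LsetD by blast

lemma mult_cof_mat: "F * cof_mat F n k = minor_sum F n k \<cdot>\<^sub>m 1\<^sub>m n - cof_mat F n (Suc k)"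
proof (rule eq_matI)
  fix i j assume "i < dim_row (minor_sum F n k \<cdot>\<^sub>m 1\<^sub>m n - cof_mat F n (Suc k))"
    "j < dim_col (minor_sum F n k \<cdot>\<^sub>m 1\<^sub>m n - cof_mat F n (Suc k))"
  then have ij: "i < n" "j < n" by (auto simp: cof_mat_def)
  have "(F * cof_mat F n k) $$ (i, j) = (\<Sum>l<n. F $$ (i, l) * (\<Sum>\<beta>\<in>Lset k n. cof F \<beta> l j))"
    unfolding mult_mat_index[OF carrier cof_mat_carrier ij]
    using ij by (intro sum.cong) (auto simp: cof_mat_def)
  then show "(F * cof_mat F n k) $$ (i, j) = (minor_sum F n k \<cdot>\<^sub>m 1\<^sub>m n - cof_mat F n (Suc k)) $$ (i, j)"
    using cof_mat_Suc_index[OF ij(1), where j = j and k = k] ij by (auto simp: cof_mat_def algebra_simps)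
qed (use carrier in \<open>auto simp: cof_mat_def\<close>)

lemma col_times_cof_eq:
  assumes S: "S \<subseteq> {0..<n}" "j \<in> S"
  shows "(\<Sum>l\<in>S. cof F S i l * F $$ (l, j)) = (if i = j then hdet_on S F else 0)"
proof -
  have "qcnj (\<Sum>l\<in>S. F $$ (j, l) * cof F S l i) = (\<Sum>l\<in>S. cof F S i l * F $$ (l, j))"
    using S by (auto simp: qcnj_cof herm subset_iff intro!: sum.cong)
  then show ?thesis
    unfolding row_times_cof_eq[OF S] using hdet_on_real[OF S(1)] by (auto simp: is_real_def)
qed

text \<open>Turns the numerators of the theorem into entries of a matrix product. Sets without
  \<open>i\<close> may be added to the sum because their cofactors in row \<open>i\<close>
  vanish.\<close>

lemma sum_cdet_on_replace_col:
  assumes b: "dim_vec b = n" and i: "i < n"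
  shows "(\<Sum>\<beta>\<in>Lset_with k n i. cdet_on \<beta> i (replace_col F i b)) =
    (\<Sum>l<n. cof_mat F n k $$ (i, l) * b $ l)"
proof -
  have "(\<Sum>\<beta>\<in>Lset_with k n i. cdet_on \<beta> i (replace_col F i b)) =
      (\<Sum>\<beta>\<in>Lset_with k n i. \<Sum>l<n. cof F \<beta> i l * b $ l)"
  proof (rule sum.cong[OF refl])
    fix \<beta> assume "\<beta> \<in> Lset_with k n i"
    then have "\<beta> \<subseteq> {0..<n}" "i \<in> \<beta>" using LsetD by (auto simp: Lset_with_def)
    then show "cdet_on \<beta> i (replace_col F i b) = (\<Sum>l<n. cof F \<beta> i l * b $ l)"
      by (simp add: cdet_on_replace_col[OF carrier] sum_cof_outside)
  qed
  also have "\<dots> = (\<Sum>\<beta>\<in>Lset k n. \<Sum>l<n. cof F \<beta> i l * b $ l)"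
    by (rule sum.mono_neutral_left) (auto simp: finite_Lset Lset_with_def cof_outside)
  also have "\<dots> = (\<Sum>l<n. cof_mat F n k $$ (i, l) * b $ l)"
    using i by (subst sum.swap) (simp add: cof_mat_def sum_distrib_right)
  finally show ?thesis .
qed

lemma sum_rdet_on_replace_row:
  assumes b: "dim_vec b = n" and i: "i < n"
  shows "(\<Sum>\<beta>\<in>Lset_with k n i. rdet_on \<beta> i (replace_row F i b)) =
    (\<Sum>l<n. b $ l * cof_mat F n k $$ (l, i))"
proof -
  have "(\<Sum>\<beta>\<in>Lset_with k n i. rdet_on \<beta> i (replace_row F i b)) =
      (\<Sum>\<beta>\<in>Lset_with k n i. \<Sum>l<n. b $ l * cof F \<beta> l i)"
  proof (rule sum.cong[OF refl])
    fix \<beta> assume "\<beta> \<in> Lset_with k n i"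
    then have "\<beta> \<subseteq> {0..<n}" "i \<in> \<beta>" using LsetD by (auto simp: Lset_with_def)
    then show "rdet_on \<beta> i (replace_row F i b) = (\<Sum>l<n. b $ l * cof F \<beta> l i)"
      by (simp add: rdet_on_replace_row sum_cof_outside)
  qed
  also have "\<dots> = (\<Sum>\<beta>\<in>Lset k n. \<Sum>l<n. b $ l * cof F \<beta> l i)"
    by (rule sum.mono_neutral_left) (auto simp: finite_Lset Lset_with_def cof_outside)
  also have "\<dots> = (\<Sum>l<n. b $ l * cof_mat F n k $$ (l, i))"
    using i by (subst sum.swap) (simp add: cof_mat_def sum_distrib_left)
  finally show ?thesis .
qed

end

section \<open>Rank\<close>

text \<open>Gaussian elimination, one equation at a time. Coefficients stand on the left and
  unknowns on the right, so row operations multiply from the left and never disturb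
  \<open>c\<close>.\<close>

lemma exists_kernel_vector:
  fixes y :: "'i \<Rightarrow> 'j \<Rightarrow> 'a :: division_ring"
  assumes "finite I" "finite J" "card I < card J"
  shows "\<exists>c. (\<exists>j\<in>J. c j \<noteq> 0) \<and> (\<forall>i\<in>I. (\<Sum>j\<in>J. y i j * c j) = 0)"
  using assms
proof (induction I arbitrary: J y rule: finite_induct)
  case empty
  then show ?case by (intro exI[of _ "\<lambda>_. 1"]) (auto simp: card_gt_0_iff)
next
  case (insert i I)
  show ?case
  proof (cases "\<forall>j\<in>J. y i j = 0")
    case True
    then show ?thesis using insert.IH[of J y] insert.prems insert.hyps by auto
  next
    case False
    then obtain p where p: "p \<in> J" "y i p \<noteq> 0" by blast
    let ?J = "J - {p}"
    have "card I < card ?J" using insert.prems insert.hyps p by simp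
    then obtain c where c: "\<exists>j\<in>?J. c j \<noteq> 0"
      "\<And>k. k \<in> I \<Longrightarrow> (\<Sum>j\<in>?J. (y k j - y k p * inverse (y i p) * y i j) * c j) = 0"
      using insert.IH[of ?J "\<lambda>k j. y k j - y k p * inverse (y i p) * y i j"] insert.prems by auto
    \<comment> \<open>The eliminated unknown \<open>p\<close> is solved from equation
      \<open>i\<close>.\<close>
    define c' where "c' j = (if j = p then - inverse (y i p) * (\<Sum>j\<in>?J. y i j * c j) else c j)" for j
    have split: "(\<Sum>j\<in>J. y k j * c' j) =
        (\<Sum>j\<in>?J. y k j * c j) - y k p * inverse (y i p) * (\<Sum>j\<in>?J. y i j * c j)" for k
    proof -
      have "(\<Sum>j\<in>?J. y k j * c' j) = (\<Sum>j\<in>?J. y k j * c j)"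
        by (rule sum.cong) (auto simp: c'_def)
      then show ?thesis
        using sum.remove[OF insert.prems(1) p(1), of "\<lambda>j. y k j * c' j"]
        by (simp add: c'_def mult.assoc)
    qed
    have "(\<Sum>j\<in>J. y k j * c' j) = 0" if "k \<in> insert i I" for k
    proof (cases "k = i")
      case True
      then show ?thesis using split[of i] p by simp
    next
      case False
      then have "k \<in> I" using that by simp
      from c(2)[OF this] show ?thesis
        by (simp add: split left_diff_distrib sum_subtractf sum_distrib_left mult.assoc)
    qed
    moreover have "\<exists>j\<in>J. c' j \<noteq> 0" using c(1) by (auto simp: c'_def)
    ultimately show ?thesis by blast
  qed
qed

lemma cols_right_indep_finite: "cols_right_indep A J \<Longrightarrow> finite J"
  by (auto simp: cols_right_indep_def intro: finite_subset)

lemma finite_indep_sets: "finite {J. cols_right_indep A J}"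
  by (rule finite_subset[of _ "Pow {0..<dim_col A}"]) (auto simp: cols_right_indep_def)

lemma card_le_qrank: "cols_right_indep A J \<Longrightarrow> card J \<le> qrank A"
  unfolding qrank_def using finite_indep_sets by (intro Max_ge) auto

lemma exists_indep_qrank: "\<exists>J. cols_right_indep A J \<and> card J = qrank A"
proof -
  have "cols_right_indep A {}" by (simp add: cols_right_indep_def)
  then have "qrank A \<in> card ` {J. cols_right_indep A J}"
    unfolding qrank_def using finite_indep_sets by (intro Max_in) auto
  then show ?thesis by auto
qed

text \<open>\<open>J\<close> has maximal size among the independent sets, so adding column
  \<open>l\<close> creates a relation, and in it the coefficient of \<open>l\<close> cannot
  vanish.\<close>

lemma column_in_span:
  assumes J: "cols_right_indep A J" "card J = qrank A" and l: "l < dim_col A"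
  shows "\<exists>y. \<forall>t<dim_row A. A $$ (t, l) = (\<Sum>j\<in>J. A $$ (t, j) * y j)"
proof (cases "l \<in> J")
  case True
  have "(\<Sum>j\<in>J. A $$ (t, j) * (if j = l then 1 else 0)) = A $$ (t, l)" for t
    using True cols_right_indep_finite[OF J(1)]
    by (simp add: if_distrib[of "(*) _"] cong: if_cong)
  then show ?thesis by (intro exI[of _ "\<lambda>j. if j = l then 1 else 0"]) auto
next
  case False
  have fin: "finite J" using J(1) by (rule cols_right_indep_finite)
  have "\<not> cols_right_indep A (insert l J)"
    using card_le_qrank[of A "insert l J"] False fin J(2) by auto
  moreover have "insert l J \<subseteq> {0..<dim_col A}" using J(1) l by (auto simp: cols_right_indep_def)
  ultimately obtain c where c: "\<And>t. t < dim_row A \<Longrightarrow> (\<Sum>j\<in>insert l J. A $$ (t, j) * c j) = 0"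
    "\<exists>j\<in>insert l J. c j \<noteq> 0"
    unfolding cols_right_indep_def by blast
  have "c l \<noteq> 0"
  proof
    assume "c l = 0"
    then have "\<forall>t<dim_row A. (\<Sum>j\<in>J. A $$ (t, j) * c j) = 0" using c(1) False fin by simp
    then have "\<forall>j\<in>J. c j = 0" using J(1) by (auto simp: cols_right_indep_def)
    then show False using c(2) \<open>c l = 0\<close> by auto
  qed
  have "A $$ (t, l) = (\<Sum>j\<in>J. A $$ (t, j) * (- c j * inverse (c l)))" if "t < dim_row A" for t
  proof -
    have "A $$ (t, l) * c l = - (\<Sum>j\<in>J. A $$ (t, j) * c j)"
      using c(1)[OF that] False fin by (simp add: eq_neg_iff_add_eq_0)
    then have "A $$ (t, l) * c l * inverse (c l) = - (\<Sum>j\<in>J. A $$ (t, j) * c j) * inverse (c l)" by simp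
    then show ?thesis
      using \<open>c l \<noteq> 0\<close> by (simp add: mult.assoc sum_distrib_right sum_negf)
  qed
  then show ?thesis by (intro exI[of _ "\<lambda>j. - c j * inverse (c l)"]) simp
qed

section \<open>Adjoints and their rank\<close>

lemma qadj_carrier: "A \<in> carrier_mat m n \<Longrightarrow> qadj A \<in> carrier_mat n m"
  by (simp add: qadj_def)

lemma dim_qadj [simp]: "dim_row (qadj A) = dim_col A" "dim_col (qadj A) = dim_row A"
  by (simp_all add: qadj_def)

lemma qadj_index: "i < dim_col A \<Longrightarrow> j < dim_row A \<Longrightarrow> qadj A $$ (i, j) = qcnj (A $$ (j, i))"
  by (simp add: qadj_def)

lemma qadj_qadj [simp]: "qadj (qadj A) = A"
  by (rule eq_matI) (auto simp: qadj_def)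

lemma qadj_mult:
  assumes "A \<in> carrier_mat m n" "B \<in> carrier_mat n p"
  shows "qadj (A * B) = qadj B * qadj A"
proof (rule eq_matI)
  fix i j assume "i < dim_row (qadj B * qadj A)" "j < dim_col (qadj B * qadj A)"
  then have ij: "i < p" "j < m" using assms by auto
  show "qadj (A * B) $$ (i, j) = (qadj B * qadj A) $$ (i, j)"
    unfolding mult_mat_index[OF qadj_carrier[OF assms(2)] qadj_carrier[OF assms(1)] ij]
    using ij assms mult_mat_index[OF assms ij(2,1)] by (simp add: qadj_index)
qed (use assms in auto)

text \<open>All columns of \<open>A\<close> are right combinations of those in \<open>J\<close>. If
  \<open>K\<close> were larger than \<open>J\<close>, some nonzero vector on \<open>K\<close> would
  be orthogonal to the columns in \<open>J\<close>, hence to every column of \<open>A\<close>,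
  against the independence of \<open>K\<close> in \<open>qadj A\<close>.\<close>

lemma qrank_qadj_le: "qrank (qadj A) \<le> qrank A"
proof -
  obtain J where J: "cols_right_indep A J" "card J = qrank A" using exists_indep_qrank by blast
  obtain K where K: "cols_right_indep (qadj A) K" "card K = qrank (qadj A)" using exists_indep_qrank by blast
  have KJ: "K \<subseteq> {0..<dim_row A}" "J \<subseteq> {0..<dim_col A}" using K J by (auto simp: cols_right_indep_def)
  have "\<forall>l<dim_col A. \<exists>y. \<forall>t<dim_row A. A $$ (t, l) = (\<Sum>j\<in>J. A $$ (t, j) * y j)"
    using column_in_span[OF J] by blast
  then obtain y where y: "\<And>l t. l < dim_col A \<Longrightarrow> t < dim_row A \<Longrightarrow> A $$ (t, l) = (\<Sum>j\<in>J. A $$ (t, j) * y l j)"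
    by metis
  show ?thesis
  proof (rule ccontr)
    assume "\<not> ?thesis"
    then have "card J < card K" using J K by simp
    then obtain c where c: "\<exists>t\<in>K. c t \<noteq> 0" "\<And>j. j \<in> J \<Longrightarrow> (\<Sum>t\<in>K. qcnj (A $$ (t, j)) * c t) = 0"
      using exists_kernel_vector[of J K "\<lambda>j t. qcnj (A $$ (t, j))"]
        cols_right_indep_finite[OF J(1)] cols_right_indep_finite[OF K(1)] by blast
    have "(\<Sum>t\<in>K. qadj A $$ (l, t) * c t) = 0" if l: "l < dim_col A" for l
    proof -
      have "(\<Sum>t\<in>K. qadj A $$ (l, t) * c t) = (\<Sum>t\<in>K. \<Sum>j\<in>J. qcnj (y l j) * (qcnj (A $$ (t, j)) * c t))"
      proof (rule sum.cong[OF refl])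
        fix t assume "t \<in> K"
        then have t: "t < dim_row A" using KJ by auto
        show "qadj A $$ (l, t) * c t = (\<Sum>j\<in>J. qcnj (y l j) * (qcnj (A $$ (t, j)) * c t))"
          unfolding qadj_index[OF l t] y[OF l t] by (simp add: sum_distrib_right mult.assoc)
      qed
      also have "\<dots> = 0"
        by (subst sum.swap) (simp add: sum_distrib_left[symmetric] c(2))
      finally show ?thesis .
    qed
    then have "\<forall>t\<in>K. c t = 0" using K(1) by (auto simp: cols_right_indep_def)
    then show False using c(1) by blast
  qed
qed

lemma qrank_qadj: "qrank (qadj A) = qrank A"
  using qrank_qadj_le[of A] qrank_qadj_le[of "qadj A"] by simp

section \<open>Gram matrices\<close>

lemma sum_qnorm2_eq_0:
  fixes m :: nat
  assumes "(\<Sum>t<m. qcnj (y t) * y t) = 0" "t < m"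
  shows "y t = 0"
proof -
  have nonneg: "0 \<le> qnorm2 x" for x by (simp add: qnorm2_def)
  have "(\<Sum>t<m. qnorm2 (y t)) = qRe (\<Sum>t<m. qcnj (y t) * y t)"
    by (simp only: qRe_sum qRe_qcnj_mult_self)
  then have "(\<Sum>t<m. qnorm2 (y t)) = 0" using assms(1) by simp
  then have "qnorm2 (y t) = 0" using assms(2) nonneg sum_nonneg_eq_0_iff[of "{..<m}" "\<lambda>t. qnorm2 (y t)"] by auto
  then show ?thesis using qnorm2_pos[of "y t"] by (metis less_irrefl)
qed

locale gram =
  fixes A :: "quat mat" and m n :: nat
  assumes A: "A \<in> carrier_mat m n"
begin

abbreviation "F \<equiv> qadj A * A"

lemma gram_index: "i < n \<Longrightarrow> j < n \<Longrightarrow> F $$ (i, j) = (\<Sum>t<m. qcnj (A $$ (t, i)) * A $$ (t, j))"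
  using mult_mat_index[OF qadj_carrier[OF A] A, of i j] A by (simp add: qadj_index)

sublocale hermitian F n
proof
  show "F \<in> carrier_mat n n" using A by (simp add: qadj_def)
  show "qcnj (F $$ (i, j)) = F $$ (j, i)" if "i < n" "j < n" for i j
    using that by (simp add: gram_index)
qed

lemma gram_apply:
  assumes "S \<subseteq> {0..<n}" "k < n"
  shows "(\<Sum>l\<in>S. F $$ (k, l) * c l) = (\<Sum>t<m. qcnj (A $$ (t, k)) * (\<Sum>l\<in>S. A $$ (t, l) * c l))"
proof -
  have "(\<Sum>l\<in>S. F $$ (k, l) * c l) = (\<Sum>l\<in>S. \<Sum>t<m. qcnj (A $$ (t, k)) * (A $$ (t, l) * c l))"
    using assms by (intro sum.cong refl) (auto simp: gram_index sum_distrib_right mult.assoc subset_iff)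
  then show ?thesis by (subst (asm) sum.swap) (simp add: sum_distrib_left)
qed

text \<open>Let \<open>g\<close> be column \<open>i\<close> of the cofactors of \<open>S\<close>,
  and \<open>y\<close> the product of \<open>A\<close> with \<open>g\<close>. By Cramer's rule
  \<open>F\<close> times \<open>g\<close> is \<open>hdet_on S F\<close> at \<open>i\<close> and zero
  elsewhere on \<open>S\<close>, so the squared norm of \<open>y\<close> is
  \<open>hdet_on (S - {i}) F * hdet_on S F\<close>. The first factor is the entry of
  \<open>g\<close> at \<open>i\<close> and positive by induction; hence independence gives
  \<open>y\<close> nonzero, and the second factor is positive.\<close>

lemma hdet_on_pos:
  assumes "cols_right_indep A S"
  shows "0 < qRe (hdet_on S F)"
  using cols_right_indep_finite[OF assms] assms
proof (induction S rule: finite_psubset_induct)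
  case (psubset S)
  have S: "S \<subseteq> {0..<n}" using psubset.prems A by (auto simp: cols_right_indep_def)
  show ?case
  proof (cases "S = {}")
    case False
    then obtain i where i: "i \<in> S" by blast
    let ?g = "\<lambda>l. cof F S l i"
    define y where "y t = (\<Sum>l\<in>S. A $$ (t, l) * ?g l)" for t
    have sub: "S - {i} \<subset> S" using i by blast
    have "cols_right_indep A (S - {i})"
      unfolding cols_right_indep_def
    proof (intro conjI allI impI)
      show "S - {i} \<subseteq> {0..<dim_col A}" using S A by auto
      fix c assume c: "\<forall>t<dim_row A. (\<Sum>j\<in>S - {i}. A $$ (t, j) * c j) = 0"
      define c' where "c' j = (if j = i then 0 else c j)" for j
      have "(\<Sum>j\<in>S. A $$ (t, j) * c' j) = (\<Sum>j\<in>S - {i}. A $$ (t, j) * c j)" for t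
        unfolding sum.remove[OF psubset.hyps i] by (auto simp: c'_def intro!: sum.cong)
      then have "\<forall>j\<in>S. c' j = 0" using c psubset.prems by (simp add: cols_right_indep_def)
      then show "\<forall>j\<in>S - {i}. c j = 0" by (auto simp: c'_def split: if_splits)
    qed
    then have d: "0 < qRe (hdet_on (S - {i}) F)" using psubset.IH[OF sub] by blast
    have gi: "?g i = hdet_on (S - {i}) F" by (rule cof_diag[OF i])
    have gram_g: "(\<Sum>t<m. qcnj (A $$ (t, k)) * y t) = (if k = i then hdet_on S F else 0)" if "k \<in> S" for k
      unfolding y_def using gram_apply[OF S, of k ?g] row_times_cof_eq[OF S that, of i] that S by auto
    have "(\<Sum>t<m. qcnj (y t) * y t) = (\<Sum>k\<in>S. qcnj (?g k) * (\<Sum>t<m. qcnj (A $$ (t, k)) * y t))"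
    proof -
      have "(\<Sum>t<m. qcnj (y t) * y t) = (\<Sum>t<m. \<Sum>k\<in>S. qcnj (?g k) * (qcnj (A $$ (t, k)) * y t))"
        unfolding y_def by (simp add: sum_distrib_right mult.assoc)
      then show ?thesis by (subst (asm) sum.swap) (simp add: sum_distrib_left)
    qed
    also have "\<dots> = (\<Sum>k\<in>S. if k = i then qcnj (?g i) * hdet_on S F else 0)"
      by (rule sum.cong) (auto simp: gram_g)
    also have "\<dots> = qcnj (?g i) * hdet_on S F" using psubset.hyps i by simp
    also have "qcnj (?g i) = hdet_on (S - {i}) F"
      using hdet_on_real[of "S - {i}"] S unfolding gi is_real_def by blast
    finally have e: "(\<Sum>t<m. qcnj (y t) * y t) = hdet_on (S - {i}) F * hdet_on S F" .
    have real: "is_real (hdet_on (S - {i}) F)" using S by (intro hdet_on_real) auto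
    have "(\<Sum>t<m. qnorm2 (y t)) = qRe (hdet_on (S - {i}) F) * qRe (hdet_on S F)"
      using arg_cong[OF e, of qRe] real by (simp only: qRe_sum qRe_qcnj_mult_self qRe_mult_real)
    moreover have "\<exists>t<m. y t \<noteq> 0"
    proof (rule ccontr)
      assume "\<not> ?thesis"
      then have "\<forall>l\<in>S. ?g l = 0" using psubset.prems A unfolding y_def cols_right_indep_def by auto
      then show False using gi i d by simp
    qed
    then have "0 < (\<Sum>t<m. qnorm2 (y t))"
    proof -
      obtain t where t: "t < m" "y t \<noteq> 0" using \<open>\<exists>t<m. y t \<noteq> 0\<close> by blast
      then show ?thesis using qnorm2_pos[of "y t"]
        by (intro sum_pos2[of _ t]) (auto simp: qnorm2_def)
    qed
    ultimately show ?thesis using d by (simp add: zero_less_mult_iff)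
  qed simp
qed

text \<open>A relation \<open>c\<close> among the columns is killed by \<open>F\<close> on
  \<open>S\<close>, so Cramer's rule gives \<open>hdet_on S F * c j = 0\<close> with
  \<open>c j \<noteq> 0\<close>. Once the determinant is zero, the cofactors of \<open>S\<close>
  multiplied by \<open>F\<close> give zero, and therefore row \<open>i\<close> of the cofactors
  times \<open>qadj A\<close> has norm zero.\<close>

lemma
  assumes S: "S \<subseteq> {0..<n}" and dep: "\<not> cols_right_indep A S"
  shows hdet_on_dep: "hdet_on S F = 0"
    and cof_qadj_dep: "t < m \<Longrightarrow> (\<Sum>k\<in>S. cof F S i k * qcnj (A $$ (t, k))) = 0"
proof -
  have fin: "finite S" using S finite_subset by blast
  obtain c j where c: "\<And>t. t < m \<Longrightarrow> (\<Sum>l\<in>S. A $$ (t, l) * c l) = 0" and j: "j \<in> S" "c j \<noteq> 0"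
    using dep S A unfolding cols_right_indep_def by auto
  have "hdet_on S F * c j = (\<Sum>l\<in>S. (if j = l then hdet_on S F else 0) * c l)"
    using fin j by (simp add: if_distrib[of "\<lambda>x. x * _"] cong: if_cong)
  also have "\<dots> = (\<Sum>l\<in>S. (\<Sum>k\<in>S. cof F S j k * F $$ (k, l)) * c l)"
    by (rule sum.cong) (auto simp: col_times_cof_eq[OF S])
  also have "\<dots> = (\<Sum>k\<in>S. cof F S j k * (\<Sum>l\<in>S. F $$ (k, l) * c l))"
    unfolding sum_distrib_right sum_distrib_left by (subst sum.swap) (simp add: mult.assoc)
  also have "\<dots> = 0"
    using S by (intro sum.neutral) (auto simp: gram_apply[OF S] c subset_iff)
  finally show d0: "hdet_on S F = 0" using j by simp
  define y where "y t = (\<Sum>k\<in>S. cof F S i k * qcnj (A $$ (t, k)))" for t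
  have cnj_y: "qcnj (y t) = (\<Sum>k\<in>S. A $$ (t, k) * cof F S k i)" for t
    unfolding y_def by (simp add: qcnj_cof[OF S])
  have "(\<Sum>t<m. qcnj (qcnj (y t)) * qcnj (y t)) = (\<Sum>k\<in>S. cof F S i k * (\<Sum>t<m. qcnj (A $$ (t, k)) * qcnj (y t)))"
  proof -
    have "(\<Sum>t<m. qcnj (qcnj (y t)) * qcnj (y t)) = (\<Sum>t<m. \<Sum>k\<in>S. cof F S i k * (qcnj (A $$ (t, k)) * qcnj (y t)))"
      by (simp only: qcnj_simps) (simp only: y_def sum_distrib_right mult.assoc)
    then show ?thesis by (subst (asm) sum.swap) (simp add: sum_distrib_left)
  qed
  also have "\<dots> = (\<Sum>k\<in>S. cof F S i k * (if k = i then hdet_on S F else 0))"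
  proof (rule sum.cong[OF refl])
    fix k assume k: "k \<in> S"
    then show "cof F S i k * (\<Sum>t<m. qcnj (A $$ (t, k)) * qcnj (y t)) = cof F S i k * (if k = i then hdet_on S F else 0)"
      unfolding cnj_y using gram_apply[OF S, of k "\<lambda>l. cof F S l i"] row_times_cof_eq[OF S k, of i] S by auto
  qed
  also have "\<dots> = 0" by (rule sum.neutral) (auto simp: d0)
  finally have "(\<Sum>t<m. qcnj (qcnj (y t)) * qcnj (y t)) = 0" .
  from sum_qnorm2_eq_0[OF this] have "qcnj (y t) = 0" if "t < m" for t using that by blast
  then show "t < m \<Longrightarrow> (\<Sum>k\<in>S. cof F S i k * qcnj (A $$ (t, k))) = 0"
    unfolding y_def[symmetric] by (metis qcnj_simps(5,7))
qed

lemma minor_sum_nonzero: "minor_sum F n (qrank A) \<noteq> 0"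
proof -
  obtain J where J: "cols_right_indep A J" "card J = qrank A" using exists_indep_qrank by blast
  then have "J \<in> Lset (qrank A) n" using A by (auto simp: Lset_def cols_right_indep_def)
  moreover have "0 \<le> qRe (hdet_on \<beta> F)" if "\<beta> \<in> Lset k n" for \<beta> k
    using hdet_on_pos[of \<beta>] hdet_on_dep[of \<beta>] LsetD[OF that] by (cases "cols_right_indep A \<beta>") auto
  ultimately have "0 < (\<Sum>\<beta>\<in>Lset (qrank A) n. qRe (hdet_on \<beta> F))"
    using hdet_on_pos[OF J(1)] by (intro sum_pos2[of _ J]) (auto simp: finite_Lset)
  then have "qRe (minor_sum F n (qrank A)) \<noteq> 0" by (simp add: minor_sum_def)
  then show ?thesis by auto
qed

text \<open>Every set of \<open>Suc (qrank A)\<close> columns is dependent, so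
  \<open>cof_qadj_dep\<close> removes each summand.\<close>

lemma cof_mat_Suc_qrank: "cof_mat F n (Suc (qrank A)) * qadj A = 0\<^sub>m n m"
proof (rule eq_matI)
  fix i t assume "i < dim_row (0\<^sub>m n m :: quat mat)" "t < dim_col (0\<^sub>m n m :: quat mat)"
  then have it: "i < n" "t < m" by auto
  have "(cof_mat F n (Suc (qrank A)) * qadj A) $$ (i, t) =
      (\<Sum>k<n. \<Sum>\<beta>\<in>Lset (Suc (qrank A)) n. cof F \<beta> i k * qcnj (A $$ (t, k)))"
    unfolding mult_mat_index[OF cof_mat_carrier qadj_carrier[OF A] it]
    using it A by (intro sum.cong) (auto simp: cof_mat_def qadj_index sum_distrib_right)
  also have "\<dots> = (\<Sum>\<beta>\<in>Lset (Suc (qrank A)) n. \<Sum>k<n. cof F \<beta> i k * qcnj (A $$ (t, k)))"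
    by (rule sum.swap)
  also have "\<dots> = 0"
  proof (rule sum.neutral, rule ballI)
    fix \<beta> assume \<beta>: "\<beta> \<in> Lset (Suc (qrank A)) n"
    then have "\<not> cols_right_indep A \<beta>" using card_le_qrank[of A \<beta>] LsetD[OF \<beta>] by auto
    then show "(\<Sum>k<n. cof F \<beta> i k * qcnj (A $$ (t, k))) = 0"
      using LsetD[OF \<beta>] cof_qadj_dep[of \<beta> t i] it by (simp add: sum_cof_outside)
  qed
  finally show "(cof_mat F n (Suc (qrank A)) * qadj A) $$ (i, t) = 0\<^sub>m n m $$ (i, t)" using it by simp
qed (use A in \<open>auto simp: cof_mat_def\<close>)

end

section \<open>The Moore--Penrose inverse\<close>

lemma smult_mult_mat:
  fixes c :: quat
  assumes "A \<in> carrier_mat m n" "B \<in> carrier_mat n p"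
  shows "(c \<cdot>\<^sub>m A) * B = c \<cdot>\<^sub>m (A * B)"
proof (rule eq_matI)
  fix i j assume "i < dim_row (c \<cdot>\<^sub>m (A * B))" "j < dim_col (c \<cdot>\<^sub>m (A * B))"
  then have ij: "i < m" "j < p" using assms by auto
  have "c \<cdot>\<^sub>m A \<in> carrier_mat m n" using assms(1) by simp
  from mult_mat_index[OF this assms(2) ij]
  show "((c \<cdot>\<^sub>m A) * B) $$ (i, j) = (c \<cdot>\<^sub>m (A * B)) $$ (i, j)"
    using ij assms mult_mat_index[OF assms ij] by (simp add: sum_distrib_left mult.assoc)
qed (use assms in auto)

text \<open>A left scalar can be moved across \<open>A\<close> because it is real, hence
  central.\<close>

lemma mult_smult_mat:
  assumes "A \<in> carrier_mat m n" "B \<in> carrier_mat n p" and c: "is_real c"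
  shows "A * (c \<cdot>\<^sub>m B) = c \<cdot>\<^sub>m (A * B)"
proof (rule eq_matI)
  fix i j assume "i < dim_row (c \<cdot>\<^sub>m (A * B))" "j < dim_col (c \<cdot>\<^sub>m (A * B))"
  then have ij: "i < m" "j < p" using assms by auto
  have "c \<cdot>\<^sub>m B \<in> carrier_mat n p" using assms(2) by simp
  from mult_mat_index[OF assms(1) this ij]
  show "(A * (c \<cdot>\<^sub>m B)) $$ (i, j) = (c \<cdot>\<^sub>m (A * B)) $$ (i, j)"
    using ij assms mult_mat_index[OF assms(1,2) ij]
    by (simp add: sum_distrib_left is_real_left_commute[OF c])
qed (use assms in auto)

lemma smult_smult_mat: "(a :: quat) \<cdot>\<^sub>m (b \<cdot>\<^sub>m A) = (a * b) \<cdot>\<^sub>m A"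
  by (rule eq_matI) (auto simp: mult.assoc)

lemma one_smult_mat: "(1 :: quat) \<cdot>\<^sub>m A = A"
  by (rule eq_matI) auto

lemma qadj_smult: "is_real c \<Longrightarrow> qadj (c \<cdot>\<^sub>m A) = c \<cdot>\<^sub>m qadj A"
  by (rule eq_matI) (auto simp: qadj_def qcnj_real_mult simp del: qcnj_simps(4))

text \<open>\<open>A * X\<close> and \<open>A * Y\<close> are Hermitian and each absorbs the other,
  so taking adjoints shows that they coincide; likewise \<open>X * A = Y * A\<close>. Then
  \<open>X = Y * A * X = Y * A * Y = Y\<close>.\<close>

lemma is_mp_inverse_unique:
  assumes X: "is_mp_inverse A X" and Y: "is_mp_inverse A Y"
  shows "X = Y"
proof -
  define m n where "m = dim_row A" and "n = dim_col A"
  have A: "A \<in> carrier_mat m n" by (simp add: m_def n_def)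
  have X': "X \<in> carrier_mat n m" "A * X * A = A" "X * A * X = X" "qadj (A * X) = A * X" "qadj (X * A) = X * A"
    and Y': "Y \<in> carrier_mat n m" "A * Y * A = A" "Y * A * Y = Y" "qadj (A * Y) = A * Y" "qadj (Y * A) = Y * A"
    using X Y by (simp_all add: is_mp_inverse_def m_def n_def)
  note [simp] = A X'(1) Y'(1)
  have AX: "A * X \<in> carrier_mat m m" "A * Y \<in> carrier_mat m m" "X * A \<in> carrier_mat n n" "Y * A \<in> carrier_mat n n"
    by (auto intro: mult_carrier_mat[OF A] mult_carrier_mat[OF _ A])
  have "A * X = (A * Y) * (A * X)"
    using assoc_mult_mat[OF AX(2) A X'(1)] Y'(2) by simp
  then have "A * X = (A * X) * (A * Y)"
    using qadj_mult[OF AX(2,1)] X'(4) Y'(4) by metis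
  also have "\<dots> = A * Y"
    using assoc_mult_mat[OF AX(1) A Y'(1)] X'(2) by simp
  finally have 1: "A * X = A * Y" .
  have "X * A = (X * A) * (Y * A)"
    using assoc_mult_mat[OF X'(1) A AX(4)] assoc_mult_mat[OF A Y'(1) A] Y'(2) by simp
  then have "X * A = (Y * A) * (X * A)"
    using qadj_mult[OF AX(3,4)] X'(5) Y'(5) by metis
  also have "\<dots> = Y * A"
    using assoc_mult_mat[OF Y'(1) A AX(3)] assoc_mult_mat[OF A X'(1) A] X'(2) by simp
  finally have 2: "X * A = Y * A" .
  have "X = Y * A * X" using X'(3) 2 by simp
  also have "\<dots> = Y * (A * X)" by (rule assoc_mult_mat[OF Y'(1) A X'(1)])
  also have "\<dots> = Y * A * Y" unfolding 1 by (rule assoc_mult_mat[OF Y'(1) A Y'(1), symmetric])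
  finally show ?thesis using Y'(3) by simp
qed

lemma mp_inverse_eqI: "is_mp_inverse A X \<Longrightarrow> mp_inverse A = X"
  unfolding mp_inverse_def using is_mp_inverse_unique by blast

text \<open>The recursion \<open>mult_cof_mat\<close> writes the product as a real multiple of the
  identity minus a Hermitian matrix. In effect \<open>F\<close> commutes with its cofactor
  matrices.\<close>

lemma (in hermitian) qadj_mult_cof_mat: "qadj (F * cof_mat F n k) = F * cof_mat F n k"
  unfolding mult_cof_mat using minor_sum_real
  by (intro eq_matI) (auto simp: qadj_def cof_mat_def qcnj_cof LsetD is_real_def intro!: sum.cong)

context gram
begin

text \<open>All four Penrose equations follow from \<open>F * X = qadj A\<close> and the commutation
  of \<open>F\<close> with \<open>?N\<close>.\<close>

lemma is_mp_inverse_cof_mat: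
  "is_mp_inverse A (inverse (minor_sum F n (qrank A)) \<cdot>\<^sub>m (cof_mat F n (qrank A) * qadj A))"
proof -
  let ?d = "minor_sum F n (qrank A)"
  let ?N = "cof_mat F n (qrank A)" and ?N' = "cof_mat F n (Suc (qrank A))"
  define c where "c = inverse ?d"
  define X where "X = c \<cdot>\<^sub>m (?N * qadj A)"
  have c: "is_real c" "c * ?d = 1" "?d * c = 1"
    using minor_sum_real minor_sum_nonzero by (auto simp: c_def)
  have A': "qadj A \<in> carrier_mat n m" using A by (rule qadj_carrier)
  have N: "?N \<in> carrier_mat n n" by (rule cof_mat_carrier)
  have N': "?N' \<in> carrier_mat n n" by (rule cof_mat_carrier)
  have NA: "?N * qadj A \<in> carrier_mat n m" using N A' by simp
  have X: "X \<in> carrier_mat n m" using NA by (simp add: X_def)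
  have AX: "A * X \<in> carrier_mat m m" and XA: "X * A \<in> carrier_mat n n" using A X by auto
  \<comment> \<open>The recursion replaces \<open>F * ?N\<close> by \<open>?d\<close> times the
    identity minus \<open>?N'\<close>; the latter vanishes against \<open>qadj A\<close>, and
    \<open>c\<close> cancels \<open>?d\<close>.\<close>
  have FX: "F * X = qadj A"
  proof -
    have "F * X = c \<cdot>\<^sub>m (F * (?N * qadj A))"
      unfolding X_def by (rule mult_smult_mat[OF carrier NA c(1)])
    also have "F * (?N * qadj A) = (?d \<cdot>\<^sub>m 1\<^sub>m n - ?N') * qadj A"
      using assoc_mult_mat[OF carrier N A'] mult_cof_mat[of "qrank A"] by simp
    also have "\<dots> = (?d \<cdot>\<^sub>m 1\<^sub>m n) * qadj A - ?N' * qadj A"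
      by (rule minus_mult_distrib_mat) (use N' A' in auto)
    also have "\<dots> = ?d \<cdot>\<^sub>m qadj A - 0\<^sub>m n m"
      by (simp add: cof_mat_Suc_qrank smult_mult_mat[OF one_carrier_mat A'] left_mult_one_mat[OF A'])
    also have "\<dots> = ?d \<cdot>\<^sub>m qadj A" using A by (intro eq_matI) auto
    finally show ?thesis by (simp add: smult_smult_mat c one_smult_mat)
  qed
  have A'AX: "qadj A * (A * X) = qadj A"
    using FX assoc_mult_mat[OF A' A X] by simp
  then have AXadj_A: "qadj (A * X) * A = A"
    using qadj_mult[OF A' AX] by simp
  \<comment> \<open>This exhibits \<open>A * X\<close> as an adjoint times itself, which is
    Hermitian.\<close>
  have "qadj (A * X) * (A * X) = A * X"
    using assoc_mult_mat[OF qadj_carrier[OF AX] A X] AXadj_A by simp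
  then have AX_herm: "qadj (A * X) = A * X"
    using qadj_mult[OF qadj_carrier[OF AX] AX] by simp
  have XA_eq: "X * A = c \<cdot>\<^sub>m (?N * F)"
    using smult_mult_mat[OF NA A, of c] assoc_mult_mat[OF N A' A] by (simp add: X_def)
  \<comment> \<open>\<open>?N * F\<close> and \<open>F * ?N\<close> are adjoint to each other, and
    the second is Hermitian, so they agree.\<close>
  have "qadj (?N * F) = F * ?N"
    using qadj_mult[OF N carrier] qadj_mult[OF A' A] by (simp add: qadj_cof_mat)
  moreover have "qadj (F * ?N) = F * ?N"
    by (rule qadj_mult_cof_mat)
  ultimately have "qadj (?N * F) = ?N * F" by (metis qadj_qadj)
  then have XA_herm: "qadj (X * A) = X * A" by (simp add: XA_eq qadj_smult c)
  have "X * A * X = c \<cdot>\<^sub>m (?N * F * X)"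
    unfolding XA_eq by (rule smult_mult_mat[OF mult_carrier_mat[OF N carrier] X])
  also have "?N * F * X = ?N * qadj A"
    using assoc_mult_mat[OF N carrier X] FX by simp
  finally have "X * A * X = X" by (simp add: X_def)
  moreover have "A * X * A = A" using AXadj_A AX_herm by simp
  ultimately show ?thesis
    unfolding is_mp_inverse_def c_def[symmetric] X_def[symmetric]
    using X A AX_herm XA_herm by auto
qed

end

lemma mp_inverse_eq_cof_mat:
  assumes "A \<in> carrier_mat m n"
  shows "mp_inverse A = inverse (minor_sum (qadj A * A) n (qrank A)) \<cdot>\<^sub>m
    (cof_mat (qadj A * A) n (qrank A) * qadj A)"
  by (rule mp_inverse_eqI, rule gram.is_mp_inverse_cof_mat) (use assms in \<open>unfold_locales\<close>)

lemma is_mp_inverse_mp_inverse: "is_mp_inverse A (mp_inverse A)"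
proof -
  interpret gram A "dim_row A" "dim_col A" by unfold_locales auto
  show ?thesis using is_mp_inverse_cof_mat mp_inverse_eqI by metis
qed

lemma mp_inverse_carrier: "A \<in> carrier_mat m n \<Longrightarrow> mp_inverse A \<in> carrier_mat n m"
  using is_mp_inverse_mp_inverse[of A] by (auto simp: is_mp_inverse_def)

lemma mp_inverse_qadj: "mp_inverse (qadj A) = qadj (mp_inverse A)"
proof (rule mp_inverse_eqI)
  define m n where "m = dim_row A" and "n = dim_col A"
  define X where "X = mp_inverse A"
  have A: "A \<in> carrier_mat m n" by (simp add: m_def n_def)
  have X: "X \<in> carrier_mat n m" unfolding X_def by (rule mp_inverse_carrier[OF A])
  have mp: "A * X * A = A" "X * A * X = X" "qadj (A * X) = A * X" "qadj (X * A) = X * A"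
    using is_mp_inverse_mp_inverse[of A] by (simp_all add: is_mp_inverse_def X_def)
  note A' = qadj_carrier[OF A] and X' = qadj_carrier[OF X]
  have AX: "A * X \<in> carrier_mat m m" and XA: "X * A \<in> carrier_mat n n" using A X by auto
  have 1: "qadj A * qadj X = X * A" and 2: "qadj X * qadj A = A * X"
    using qadj_mult[OF X A] qadj_mult[OF A X] mp by simp_all
  have "X * A * qadj A = qadj A"
    using qadj_mult[OF A XA] assoc_mult_mat[OF A X A] mp by simp
  moreover have "A * X * qadj X = qadj X"
    using qadj_mult[OF X AX] assoc_mult_mat[OF X A X] mp by simp
  ultimately show "is_mp_inverse (qadj A) (qadj (mp_inverse A))"
    unfolding is_mp_inverse_def X_def[symmetric] 1 2 using mp X' A by simp
qed

text \<open>This is the column formula for \<open>qadj A\<close>, whose Gram matrix is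
  \<open>A * qadj A\<close> and whose rank is \<open>qrank A\<close>; taking adjoints moves the
  cofactor matrix to the right.\<close>

lemma mp_inverse_eq_cof_mat_right:
  assumes "A \<in> carrier_mat m n"
  shows "mp_inverse A = inverse (minor_sum (A * qadj A) m (qrank A)) \<cdot>\<^sub>m
    (qadj A * cof_mat (A * qadj A) m (qrank A))"
proof -
  interpret gram "qadj A" n m by unfold_locales (rule qadj_carrier[OF assms])
  have "qadj (mp_inverse A) = inverse (minor_sum (A * qadj A) m (qrank A)) \<cdot>\<^sub>m
      (cof_mat (A * qadj A) m (qrank A) * A)"
    using mp_inverse_eq_cof_mat[OF qadj_carrier[OF assms]]
    unfolding mp_inverse_qadj qrank_qadj qadj_qadj .
  from arg_cong[OF this, of qadj] show ?thesis
    using minor_sum_real qadj_cof_mat qadj_mult[OF cof_mat_carrier assms]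
    by (simp add: qadj_smult is_real_intros(5))
qed

section \<open>From cofactor matrices back to sums of determinants\<close>

lemma sum_cdet_gram:
  assumes A: "A \<in> carrier_mat m n" and B: "B \<in> carrier_mat n p" and ij: "i < n" "j < p"
  shows "(\<Sum>\<beta>\<in>Lset_with k n i. cdet_on \<beta> i (replace_col (qadj A * A) i (col B j))) =
    (cof_mat (qadj A * A) n k * B) $$ (i, j)"
proof -
  interpret gram A m n by unfold_locales (rule A)
  show ?thesis
    unfolding mult_mat_index[OF cof_mat_carrier B ij]
    using B ij by (subst sum_cdet_on_replace_col) (auto intro!: sum.cong)
qed

lemma sum_rdet_gram:
  assumes A: "A \<in> carrier_mat n m" and B: "B \<in> carrier_mat p n" and ij: "i < p" "j < n"
  shows "(\<Sum>\<beta>\<in>Lset_with k n j. rdet_on \<beta> j (replace_row (A * qadj A) j (row B i))) =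
    (B * cof_mat (A * qadj A) n k) $$ (i, j)"
proof -
  interpret gram "qadj A" m n by unfold_locales (rule qadj_carrier[OF A])
  show ?thesis
    unfolding mult_mat_index[OF B cof_mat_carrier ij]
    using sum_rdet_on_replace_row[of "row B i" j k] B ij by (auto intro!: sum.cong)
qed

theorem theorem4p2:
  fixes A1 A2 B2 C :: "quat mat" and m n p q s r1 r2 r3 r4 :: nat
  assumes A1: "A1 \<in> carrier_mat m n" and rA1: "qrank A1 = r1"
    and A2: "A2 \<in> carrier_mat m p" and rA2: "qrank A2 = r2"
    and B2: "B2 \<in> carrier_mat q s" and rB2: "qrank B2 = r3"
    and C: "C \<in> carrier_mat m s"
    and rM: "qrank (R_proj A1 * A2) = min (qrank A2) (qrank (R_proj A1))"
    and r4: "qrank (R_proj A1 * A2) = r4"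
  shows
   "let M = R_proj A1 * A2;
        X1 = mp_inverse A1 * C - mp_inverse A1 * A2 * mp_inverse M * C;
        X2 = mp_inverse M * C * mp_inverse B2;
        A2t = qadj A1 * A2;
        C1 = qadj A1 * C;
        C2 = qadj M * C;
        C3 = qadj M * C * qadj B2;
        AA = qadj A1 * A1;
        MM = qadj M * M;
        BB = B2 * qadj B2;
        D1 = (\<Sum>\<beta>\<in>Lset r1 n. hdet_on \<beta> AA);
        D4 = (\<Sum>\<beta>\<in>Lset r4 p. hdet_on \<beta> MM);
        D3 = (\<Sum>\<alpha>\<in>Lset r3 q. hdet_on \<alpha> BB);
        dB2 = (\<lambda>f. vec p (\<lambda>k. \<Sum>\<alpha>\<in>Lset_with r3 q f. rdet_on \<alpha> f (replace_row BB f (row C3 k))));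
        dM = (\<lambda>g. vec q (\<lambda>l. \<Sum>\<beta>\<in>Lset_with r4 p g. cdet_on \<beta> g (replace_col MM g (col C3 l))))
    in (\<forall>i<n. \<forall>j<s.
          X1 $$ (i, j) =
            (\<Sum>\<beta>\<in>Lset_with r1 n i. cdet_on \<beta> i (replace_col AA i (col C1 j))) * inverse D1
          - (\<Sum>t<p. (\<Sum>\<beta>\<in>Lset_with r1 n i. cdet_on \<beta> i (replace_col AA i (col A2t t)))
                   * (\<Sum>\<beta>\<in>Lset_with r4 p t. cdet_on \<beta> t (replace_col MM t (col C2 j))))
              * inverse (D1 * D4))
     \<and> (\<forall>g<p. \<forall>f<q.
          X2 $$ (g, f) =
            (\<Sum>\<beta>\<in>Lset_with r4 p g. cdet_on \<beta> g (replace_col MM g (dB2 f))) * inverse (D4 * D3)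
        \<and> X2 $$ (g, f) =
            (\<Sum>\<alpha>\<in>Lset_with r3 q f. rdet_on \<alpha> f (replace_row BB f (dM g))) * inverse (D4 * D3))"
proof -
  define M where "M = R_proj A1 * A2"
  define N1 D1 where "N1 = cof_mat (qadj A1 * A1) n r1" and "D1 = minor_sum (qadj A1 * A1) n r1"
  define N4 D4 where "N4 = cof_mat (qadj M * M) p r4" and "D4 = minor_sum (qadj M * M) p r4"
  define N3 D3 where "N3 = cof_mat (B2 * qadj B2) q r3" and "D3 = minor_sum (B2 * qadj B2) q r3"
  define C3 where "C3 = qadj M * C * qadj B2"
  have M: "M \<in> carrier_mat m p"
    using mult_carrier_mat[OF A1 mp_inverse_carrier[OF A1]] A1 unfolding M_def R_proj_def
    by (intro mult_carrier_mat[OF _ A2] minus_carrier_mat)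
  have N1: "N1 \<in> carrier_mat n n" and N4: "N4 \<in> carrier_mat p p" and N3: "N3 \<in> carrier_mat q q"
    by (simp_all add: N1_def N4_def N3_def cof_mat_carrier)
  note A1' = qadj_carrier[OF A1] and M' = qadj_carrier[OF M] and B2' = qadj_carrier[OF B2]
  have C1: "qadj A1 * C \<in> carrier_mat n s" and C2: "qadj M * C \<in> carrier_mat p s"
    and A2t: "qadj A1 * A2 \<in> carrier_mat n p" and C3: "C3 \<in> carrier_mat p q"
    using A1' M' C A2 B2' by (auto simp: C3_def)
  interpret g1: gram A1 m n by unfold_locales (rule A1)
  interpret g4: gram M m p by unfold_locales (rule M)
  interpret g3: gram "qadj B2" s q by unfold_locales (rule B2')
  have real: "is_real D1" "is_real D4" "is_real D3"
    using g1.minor_sum_real g4.minor_sum_real g3.minor_sum_real by (simp_all add: D1_def D4_def D3_def)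
  then have inv_real: "is_real (inverse D1)" "is_real (inverse D4)" "is_real (inverse D3)" by auto
  \<comment> \<open>Inversion reverses products; reality restores the order, and
    \<open>inverse_zero\<close> covers a vanishing factor.\<close>
  have inv14: "inverse (D1 * D4) = inverse D1 * inverse D4" and inv43: "inverse (D4 * D3) = inverse D4 * inverse D3"
    using is_real_commute[OF real(1), of D4] is_real_commute[OF real(2), of D3]
    by (metis nonzero_inverse_mult_distrib inverse_zero mult_zero_left mult_zero_right)+
  have mpA1: "mp_inverse A1 = inverse D1 \<cdot>\<^sub>m (N1 * qadj A1)"
    using mp_inverse_eq_cof_mat[OF A1] by (simp add: rA1 N1_def D1_def)
  have mpM: "mp_inverse M = inverse D4 \<cdot>\<^sub>m (N4 * qadj M)"
    using mp_inverse_eq_cof_mat[OF M] r4 by (simp add: M_def N4_def D4_def)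
  have mpB2: "mp_inverse B2 = inverse D3 \<cdot>\<^sub>m (qadj B2 * N3)"
    using mp_inverse_eq_cof_mat_right[OF B2] by (simp add: rB2 N3_def D3_def)
  have mpA1_mult: "mp_inverse A1 * Y = inverse D1 \<cdot>\<^sub>m (N1 * (qadj A1 * Y))" if "Y \<in> carrier_mat m k" for Y k
    unfolding mpA1 using smult_mult_mat[of "N1 * qadj A1" n m Y k] assoc_mult_mat[OF N1 A1' that] N1 A1' that by simp
  have mpM_C: "mp_inverse M * C = inverse D4 \<cdot>\<^sub>m (N4 * (qadj M * C))"
    unfolding mpM using smult_mult_mat[of "N4 * qadj M" p m C s] assoc_mult_mat[OF N4 M' C] N4 M' C by simp
  have cdet1: "(\<Sum>\<beta>\<in>Lset_with r1 n i. cdet_on \<beta> i (replace_col (qadj A1 * A1) i (col Y j))) = (N1 * Y) $$ (i, j)"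
    if "Y \<in> carrier_mat n k" "i < n" "j < k" for Y i j k
    unfolding N1_def by (rule sum_cdet_gram[OF A1 that])
  have cdet4: "(\<Sum>\<beta>\<in>Lset_with r4 p i. cdet_on \<beta> i (replace_col (qadj M * M) i (col Y j))) = (N4 * Y) $$ (i, j)"
    if "Y \<in> carrier_mat p k" "i < p" "j < k" for Y i j k
    unfolding N4_def by (rule sum_cdet_gram[OF M that])
  have rdet3: "(\<Sum>\<beta>\<in>Lset_with r3 q j. rdet_on \<beta> j (replace_row (B2 * qadj B2) j (row Y i))) = (Y * N3) $$ (i, j)"
    if "Y \<in> carrier_mat k q" "i < k" "j < q" for Y i j k
    unfolding N3_def by (rule sum_rdet_gram[OF B2 that])
  \<comment> \<open>In \<open>(mp_inverse A1 * A2) * (mp_inverse M * C)\<close> the sum over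
    \<open>t\<close> is the one over the inner index of the middle product; the real denominators
    then move to the right.\<close>
  have X1: "(mp_inverse A1 * C - mp_inverse A1 * A2 * mp_inverse M * C) $$ (i, j) =
      (N1 * (qadj A1 * C)) $$ (i, j) * inverse D1 -
      (\<Sum>t<p. (N1 * (qadj A1 * A2)) $$ (i, t) * (N4 * (qadj M * C)) $$ (t, j)) * inverse (D1 * D4)"
    if ij: "i < n" "j < s" for i j
  proof -
    have X: "mp_inverse A1 * A2 \<in> carrier_mat n p" and Y: "mp_inverse M * C \<in> carrier_mat p s"
      using mp_inverse_carrier[OF A1] mp_inverse_carrier[OF M] A2 C by auto
    have "(mp_inverse A1 * A2 * mp_inverse M * C) $$ (i, j) =
        (\<Sum>t<p. (mp_inverse A1 * A2) $$ (i, t) * (mp_inverse M * C) $$ (t, j))"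
      using assoc_mult_mat[OF X mp_inverse_carrier[OF M] C] mult_mat_index[OF X Y ij] by simp
    also have "\<dots> = (\<Sum>t<p. inverse D1 * (N1 * (qadj A1 * A2)) $$ (i, t) *
        (inverse D4 * (N4 * (qadj M * C)) $$ (t, j)))"
      using ij N1 N4 C A2 by (intro sum.cong) (auto simp: mpA1_mult[OF A2] mpM_C)
    also have "\<dots> = (\<Sum>t<p. (N1 * (qadj A1 * A2)) $$ (i, t) * (N4 * (qadj M * C)) $$ (t, j)) * inverse (D1 * D4)"
      unfolding inv14 sum_distrib_right
      by (intro sum.cong refl)
        (metis is_real_commute[OF inv_real(1)] is_real_commute[OF inv_real(2)] mult.assoc)
    finally show ?thesis
      using ij C N1 A1' A2 mp_inverse_carrier[OF A1] mp_inverse_carrier[OF M]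
      by (simp add: mpA1_mult[OF C] is_real_commute[OF inv_real(1)])
  qed
  \<comment> \<open>The factors \<open>qadj M\<close>, \<open>C\<close> and \<open>qadj B2\<close>
    merge into \<open>C3\<close>, flanked by the two cofactor matrices.\<close>
  have X2: "(mp_inverse M * C * mp_inverse B2) $$ (g, f) = (N4 * C3 * N3) $$ (g, f) * inverse (D4 * D3)"
    if gf: "g < p" "f < q" for g f
  proof -
    have Y: "N4 * (qadj M * C) \<in> carrier_mat p s" and Z: "qadj B2 * N3 \<in> carrier_mat s q"
      using N4 C2 N3 B2' by auto
    have "mp_inverse M * C * mp_inverse B2 = inverse D4 \<cdot>\<^sub>m (inverse D3 \<cdot>\<^sub>m (N4 * (qadj M * C) * (qadj B2 * N3)))"
      unfolding mpM_C mpB2 using smult_mult_mat[OF Y, of "inverse D3 \<cdot>\<^sub>m (qadj B2 * N3)" q "inverse D4"] Z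
        mult_smult_mat[OF Y Z inv_real(3)] by simp
    also have "N4 * (qadj M * C) * (qadj B2 * N3) = N4 * (qadj M * C) * qadj B2 * N3"
      by (rule assoc_mult_mat[OF Y B2' N3, symmetric])
    also have "N4 * (qadj M * C) * qadj B2 = N4 * C3"
      unfolding C3_def by (rule assoc_mult_mat[OF N4 C2 B2'])
    finally show ?thesis
      using gf N4 C3 N3 is_real_commute[OF is_real_intros(3)[OF inv_real(2,3)]]
      by (simp add: inv43 smult_smult_mat)
  qed
  \<comment> \<open>The auxiliary vectors are a column of \<open>C3 * N3\<close> and a row of
    \<open>N4 * C3\<close>, so the two formulas for \<open>X2\<close> are the two bracketings of
    \<open>N4 * C3 * N3\<close>.\<close>
  have dB2: "vec p (\<lambda>k. \<Sum>\<alpha>\<in>Lset_with r3 q f. rdet_on \<alpha> f (replace_row (B2 * qadj B2) f (row C3 k))) =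
      col (C3 * N3) f" if "f < q" for f
    using that C3 N3 rdet3[OF C3] by (intro eq_vecI) auto
  have dM: "vec q (\<lambda>l. \<Sum>\<beta>\<in>Lset_with r4 p g. cdet_on \<beta> g (replace_col (qadj M * M) g (col C3 l))) =
      row (N4 * C3) g" if "g < p" for g
    using that C3 N4 cdet4[OF C3] by (intro eq_vecI) auto
  have assoc: "N4 * C3 * N3 = N4 * (C3 * N3)" by (rule assoc_mult_mat[OF N4 C3 N3])
  have C3N3: "C3 * N3 \<in> carrier_mat p q" and N4C3: "N4 * C3 \<in> carrier_mat p q" using C3 N3 N4 by auto
  show ?thesis
    unfolding Let_def M_def[symmetric] minor_sum_def[symmetric] D1_def[symmetric] D4_def[symmetric]
      D3_def[symmetric] C3_def[symmetric]
    by (simp add: X1 X2 dB2 dM cdet1[OF C1] cdet1[OF A2t] cdet4[OF C2] cdet4[OF C3N3] rdet3[OF N4C3] assoc)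
qed

end
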